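(* Let $G$ be a connected graph with exactly $m$ edges, and suppose $G$ is not a $4$-cycle. Then \[\iota(G,\mathcal{C}') \le \frac{m+1}{6}.\] Moreover: (i) equality $\iota(G,\mathcal{C}') = \frac{m+1}{6}$ holds if and only if $G$ is a pure $(m,C_4)$-special graph or $G$ is isomorphic to the diamond graph $C_4'$ or to the $5$-cycle $C_5$; (ii) if $G$ is an $(m,C_4)$-special graph, then $\iota(G,\mathcal{C}') = \lfloor (m+1)/6 \rfloor$.
   Context: All graphs are finite and simple. For a graph $G$ and $v\in V(G)$, $N[v]$ is the closed neighbourhood of $v$; for $D\subseteq V(G)$, $N[D]=\bigcup_{v\in D}N[v]$. For a set $\mathcal{F}$ of graphs, an $\mathcal{F}$-graph is a graph isomorphic to a member of $\mathcal{F}$. A set $D\subseteq V(G)$ is an $\mathcal{F}$-isolating set of $G$ if $G-N[D]$ contains no $\mathcal{F}$-graph as a subgraph (equivalently, $N[D]$ meets the vertex set of every $\mathcal{F}$-graph contained in $G$); $\iota(G,\mathcal{F})$ is the minimum size of an $\mathcal{F}$-isolating set of $G$. $\mathcal{C}'$ denotes the set of all cycles of length at least $4$. $C_n$ is the $n$-cycle; the diamond graph $C_4'$ is the graph on $\{1,2,3,4\}$ with edges $12,23,34,41,13$. $(m,C_4)$-special graphs: let $m\ge 0$ and write $m+1 = 6q + r$ with integers $q\ge 0$, $0\le r\le 5$. If $q=0$, an $(m,C_4)$-special graph is any connected $m$-edge graph (it has no $C_4$-constituents). If $q\ge 1$: take distinct vertices $v_1,\dots,v_q$, and vertex-disjoint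 $4$-cycles $F_1,\dots,F_q$ (also disjoint from $\{v_1,\dots,v_q\}$); for each $i$ choose $w_i\in V(F_i)$ and let $G_i$ be the graph with vertex set $\{v_i\}\cup V(F_i)$ and edge set $E(F_i)\cup\{v_iw_i\}$. Let $T$ be any tree with vertex set $\{v_1,\dots,v_q\}$, and let $T'$ be any connected graph with exactly $r$ edges such that $V(T')\cap\bigcup_{i=1}^q V(G_i)=\{v_q\}$. The graph $G$ with $V(G)=V(T')\cup\bigcup_i V(G_i)$ and $E(G)=E(T)\cup E(T')\cup\bigcup_i E(G_i)$ is an $(m,C_4)$-special graph (a connected $m$-edge graph); the $G_i$ are its $C_4$-constituents, $T'$ is its remainder graph. It is pure if its remainder graph has no edges. *)

theory Defs
  imports Complex_Main
begin

record 'a ugraph =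
  verts :: "'a set"
  edges :: "'a set set"

definition simple_graph :: "'a ugraph \<Rightarrow> bool" where
  "simple_graph G \<longleftrightarrow>
     finite (verts G) \<and> (\<forall>e\<in>edges G. e \<subseteq> verts G \<and> card e = 2)"

definition subgraph_of :: "'a ugraph \<Rightarrow> 'a ugraph \<Rightarrow> bool" where
  "subgraph_of H G \<longleftrightarrow>
     simple_graph H \<and> verts H \<subseteq> verts G \<and> edges H \<subseteq> edges G"

definition delete_verts :: "'a ugraph \<Rightarrow> 'a set \<Rightarrow> 'a ugraph" where
  "delete_verts G X =
     \<lparr>verts = verts G - X, edges = {e \<in> edges G. e \<inter> X = {}}\<rparr>"

definition graph_iso :: "'a ugraph \<Rightarrow> 'b ugraph \<Rightarrow> bool" where
  "graph_iso G H \<longleftrightarrow>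
     (\<exists>f. bij_betw f (verts G) (verts H) \<and>
        (\<forall>u\<in>verts G. \<forall>v\<in>verts G. {u, v} \<in> edges G \<longleftrightarrow> {f u, f v} \<in> edges H))"

definition connected_graph :: "'a ugraph \<Rightarrow> bool" where
  "connected_graph G \<longleftrightarrow>
     verts G \<noteq> {} \<and>
     (\<forall>u\<in>verts G. \<forall>v\<in>verts G. (u, v) \<in> {(x, y). {x, y} \<in> edges G}\<^sup>*)"

definition closed_nbhd :: "'a ugraph \<Rightarrow> 'a \<Rightarrow> 'a set" where
  "closed_nbhd G v = {v} \<union> {u. {v, u} \<in> edges G}"

definition closed_nbhd_set :: "'a ugraph \<Rightarrow> 'a set \<Rightarrow> 'a set" where
  "closed_nbhd_set G D = (\<Union>v\<in>D. closed_nbhd G v)"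

text \<open>The family \<open>F\<close> may live on a vertex type different from that of the graph under
  consideration, since only isomorphism with its members matters.\<close>

definition contains_family :: "'b ugraph set \<Rightarrow> 'a ugraph \<Rightarrow> bool" where
  "contains_family F G \<longleftrightarrow> (\<exists>H. subgraph_of H G \<and> (\<exists>K\<in>F. graph_iso H K))"

definition isolating_set :: "'a ugraph \<Rightarrow> 'b ugraph set \<Rightarrow> 'a set \<Rightarrow> bool" where
  "isolating_set G F D \<longleftrightarrow>
     D \<subseteq> verts G \<and> \<not> contains_family F (delete_verts G (closed_nbhd_set G D))"

definition isolation_number :: "'a ugraph \<Rightarrow> 'b ugraph set \<Rightarrow> nat" where
  "isolation_number G F = (LEAST k. \<exists>D. isolating_set G F D \<and> card D = k)"

text \<open>Only meaningful for \<open>n \<ge> 3\<close>.\<close>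

definition cycle_graph :: "nat \<Rightarrow> nat ugraph" where
  "cycle_graph n =
     \<lparr>verts = {1..n}, edges = {{i, i + 1} | i. 1 \<le> i \<and> i < n} \<union> {{n, 1}}\<rparr>"

definition long_cycles :: "nat ugraph set" where
  "long_cycles = {cycle_graph n | n. n \<ge> 4}"

definition diamond_graph :: "nat ugraph" where
  "diamond_graph =
     \<lparr>verts = {1, 2, 3, 4}, edges = {{1, 2}, {2, 3}, {3, 4}, {4, 1}, {1, 3}}\<rparr>"

definition tree :: "'a ugraph \<Rightarrow> bool" where
  "tree T \<longleftrightarrow>
     simple_graph T \<and> connected_graph T \<and>
     \<not> contains_family {cycle_graph n | n. n \<ge> 3} T"

definition constituent :: "'a \<Rightarrow> 'a ugraph \<Rightarrow> 'a \<Rightarrow> 'a ugraph" where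
  "constituent v F w =
     \<lparr>verts = {v} \<union> verts F, edges = edges F \<union> {{v, w}}\<rparr>"

text \<open>\<open>special_decomposition q r G v F w T T'\<close> says that \<open>G\<close> is the graph built from
  the data \<open>v\<^sub>i\<close>, \<open>F\<^sub>i\<close>, \<open>w\<^sub>i\<close> (\<open>1 \<le> i \<le> q\<close>), the tree \<open>T\<close> on the \<open>v\<^sub>i\<close>, and the remainder
  graph \<open>T'\<close>.\<close>

definition special_decomposition ::
  "nat \<Rightarrow> nat \<Rightarrow> 'a ugraph \<Rightarrow> (nat \<Rightarrow> 'a) \<Rightarrow> (nat \<Rightarrow> 'a ugraph) \<Rightarrow> (nat \<Rightarrow> 'a) \<Rightarrow>
   'a ugraph \<Rightarrow> 'a ugraph \<Rightarrow> bool" where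
  "special_decomposition q r G v F w T T' \<longleftrightarrow>
     q \<ge> 1 \<and>
     inj_on v {1..q} \<and>
     (\<forall>i\<in>{1..q}. simple_graph (F i) \<and> graph_iso (F i) (cycle_graph 4) \<and>
        verts (F i) \<inter> v ` {1..q} = {} \<and> w i \<in> verts (F i)) \<and>
     (\<forall>i\<in>{1..q}. \<forall>j\<in>{1..q}. i \<noteq> j \<longrightarrow> verts (F i) \<inter> verts (F j) = {}) \<and>
     tree T \<and> verts T = v ` {1..q} \<and>
     simple_graph T' \<and> connected_graph T' \<and> card (edges T') = r \<and>
     verts T' \<inter> (\<Union>i\<in>{1..q}. verts (constituent (v i) (F i) (w i))) = {v q} \<and>
     verts G = verts T' \<union> (\<Union>i\<in>{1..q}. verts (constituent (v i) (F i) (w i))) \<and>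
     edges G = edges T \<union> edges T' \<union> (\<Union>i\<in>{1..q}. edges (constituent (v i) (F i) (w i)))"

definition C4_special :: "nat \<Rightarrow> 'a ugraph \<Rightarrow> bool" where
  "C4_special m G \<longleftrightarrow>
     (let q = (m + 1) div 6; r = (m + 1) mod 6 in
      if q = 0 then simple_graph G \<and> connected_graph G \<and> card (edges G) = m
      else \<exists>v F w T T'. special_decomposition q r G v F w T T')"

text \<open>A special graph without constituents (\<open>m + 1 < 6\<close>) has no remainder graph in the sense
  of the construction, hence is not pure.\<close>

definition pure_C4_special :: "nat \<Rightarrow> 'a ugraph \<Rightarrow> bool" where
  "pure_C4_special m G \<longleftrightarrow>
     (\<exists>v F w T T'.
        special_decomposition ((m + 1) div 6) ((m + 1) mod 6) G v F w T T' \<and> edges T' = {})"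

end

theory Submission
  imports Defs "HOL-Library.Disjoint_Sets"
begin

text \<open>The upper bound is proved by strong induction on the size of a connected set \<open>S\<close> of vertices,
  where every chosen vertex costs \<open>6\<close> and every edge of the subgraph induced by \<open>S\<close> pays \<open>1\<close>: either
  \<open>S\<close> is a \<open>4\<close>-cycle, or it has an isolating set of cost at most the number \<open>m\<close> of its edges, or it
  is extremal, and then every vertex of \<open>S\<close> lies in an isolating set of cost \<open>m + 1\<close>.

  If \<open>S\<close> has a bridge, the two sides are treated separately, since a cycle never uses a bridge. Two
  extremal sides either are pure special graphs joined at their tree vertices, hence form a pure
  special graph, or one vertex can be saved; a \<open>4\<close>-cycle hanging on a bridge is paid for by the
  vertex at the other end of the bridge, which is chosen and deleted.

  If \<open>S\<close> has no bridge, an induced \<open>4\<close>-cycle with exactly two outgoing edges can be split off. So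
  assume that there is none, take a vertex \<open>v\<close> of maximum degree \<open>k\<close>, choose it and delete its
  closed neighbourhood. Every component of the rest has at least two edges to the neighbours of
  \<open>v\<close>, at least three if it is a \<open>4\<close>-cycle, and therefore saves at least one edge; counting edges
  settles \<open>k \<ge> 4\<close>. For \<open>k = 3\<close> the few tight configurations are isolated without using \<open>v\<close>, and
  for \<open>k \<le> 2\<close> the graph is a path or a cycle.

  The lower bound holds because an isolating set meets every constituent of a special graph.\<close>

section \<open>Finite sets\<close>

lemma card_index_le_if_disjoint:
  assumes "finite D" "disjoint_family_on K I" "\<And>i. i \<in> I \<Longrightarrow> D \<inter> K i \<noteq> {}"
  shows "card I \<le> card D"
proof -
  define f where "f i = (SOME x. x \<in> D \<inter> K i)" for i
  have f: "f i \<in> D \<inter> K i" if "i \<in> I" for i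
    using some_in_eq[of "D \<inter> K i"] assms(3)[OF that] unfolding f_def by blast
  have "inj_on f I"
  proof (rule inj_onI, rule ccontr)
    fix i j assume "i \<in> I" "j \<in> I" "f i = f j" "i \<noteq> j"
    then show False using f[of i] f[of j] disjoint_family_onD[OF assms(2), of i j] by auto
  qed
  then show ?thesis using f assms(1) by (intro card_inj_on_le[of f]) auto
qed

lemma two_pairs_in_tripleE:
  assumes "card A = 3" "e \<subseteq> A" "f \<subseteq> A" "card e = 2" "card f = 2" "e \<noteq> f"
  obtains a b c where "A = {a, b, c}" "distinct [a, b, c]" "e = {a, b}" "f = {b, c}"
proof -
  have finite: "finite A" using assms(1) by (intro card_ge_0_finite) simp
  then have "finite e" "finite f" using assms(2,3) finite_subset by auto
  moreover have "card (e \<union> f) \<le> 3" using card_mono[OF finite, of "e \<union> f"] assms(1-3) by simp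
  ultimately have "e \<inter> f \<noteq> {}" using assms(4,5) card_Un_disjoint[of e f] by auto
  then obtain b where "b \<in> e" "b \<in> f" by blast
  then obtain a c where ac: "e = {a, b}" "f = {b, c}" "a \<noteq> b" "b \<noteq> c"
    using assms(4,5) by (auto simp: card_2_iff)
  then have "a \<noteq> c" using assms(6) by auto
  moreover from this have "{a, b, c} = A"
    using ac assms(1-3) finite by (intro card_seteq) auto
  ultimately show ?thesis using that ac by auto
qed

section \<open>Isomorphisms and cycle graphs\<close>

lemma edge_doubletonE:
  assumes "simple_graph K" "e \<in> edges K"
  obtains a b where "e = {a, b}" "a \<noteq> b" "a \<in> verts K" "b \<in> verts K"
proof -
  have "card e = 2" "e \<subseteq> verts K" using assms by (auto simp: simple_graph_def)
  then obtain a b where "e = {a, b}" "a \<noteq> b" by (meson card_2_iff)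
  then show ?thesis using that \<open>e \<subseteq> verts K\<close> by simp
qed

lemma doubleton_in_image_iff:
  assumes "inj_on g A" "X \<subseteq> Pow A" "i \<in> A" "j \<in> A"
  shows "{g i, g j} \<in> (`) g ` X \<longleftrightarrow> {i, j} \<in> X"
  using inj_on_image_mem_iff[OF inj_on_image_Pow[OF assms(1)], of "{i, j}" X] assms by simp

lemma edges_subset_Pow: "simple_graph K \<Longrightarrow> edges K \<subseteq> Pow (verts K)"
  by (auto simp: simple_graph_def)

lemma graph_iso_sym:
  assumes "graph_iso K L" shows "graph_iso L K"
proof -
  obtain f where f: "bij_betw f (verts K) (verts L)"
    and f_edge: "\<forall>u\<in>verts K. \<forall>v\<in>verts K. {u, v} \<in> edges K \<longleftrightarrow> {f u, f v} \<in> edges L"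
    using assms unfolding graph_iso_def by blast
  define g where "g = inv_into (verts K) f"
  have g: "bij_betw g (verts L) (verts K)" unfolding g_def using f by (rule bij_betw_inv_into)
  have "{i, j} \<in> edges L \<longleftrightarrow> {g i, g j} \<in> edges K" if "i \<in> verts L" "j \<in> verts L" for i j
  proof -
    have "f (g i) = i" "f (g j) = j"
      unfolding g_def using f that by (simp_all add: bij_betw_inv_into_right)
    then show ?thesis using f_edge bij_betwE[OF g] that by metis
  qed
  then show ?thesis using g unfolding graph_iso_def by blast
qed

lemma edges_eq_image_iff:
  assumes K: "simple_graph K" and L: "simple_graph L" and g: "bij_betw g (verts L) (verts K)"
  shows "edges K = (`) g ` edges L \<longleftrightarrow>
    (\<forall>i\<in>verts L. \<forall>j\<in>verts L. {i, j} \<in> edges L \<longleftrightarrow> {g i, g j} \<in> edges K)"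
proof
  assume "edges K = (`) g ` edges L"
  then show "\<forall>i\<in>verts L. \<forall>j\<in>verts L. {i, j} \<in> edges L \<longleftrightarrow> {g i, g j} \<in> edges K"
    using doubleton_in_image_iff[OF bij_betw_imp_inj_on[OF g] edges_subset_Pow[OF L]] by simp
next
  assume g_edge: "\<forall>i\<in>verts L. \<forall>j\<in>verts L. {i, j} \<in> edges L \<longleftrightarrow> {g i, g j} \<in> edges K"
  show "edges K = (`) g ` edges L"
  proof
    show "edges K \<subseteq> (`) g ` edges L"
    proof
      fix e assume e: "e \<in> edges K"
      then obtain a b where ab: "e = {a, b}" "a \<in> verts K" "b \<in> verts K"
        using edge_doubletonE[OF K] by metis
      then obtain i j where ij: "i \<in> verts L" "j \<in> verts L" "a = g i" "b = g j"
        using bij_betw_imp_surj_on[OF g] by blast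
      then have "{i, j} \<in> edges L" using g_edge e ab(1) by simp
      then show "e \<in> (`) g ` edges L"
        using ab(1) ij(3,4) by (auto intro!: image_eqI[of _ _ "{i, j}"])
    qed
    show "(`) g ` edges L \<subseteq> edges K"
    proof (rule image_subsetI)
      fix e assume e: "e \<in> edges L"
      then obtain i j where "e = {i, j}" "i \<in> verts L" "j \<in> verts L"
        using edge_doubletonE[OF L] by metis
      then show "g ` e \<in> edges K" using g_edge e by auto
    qed
  qed
qed

lemma graph_iso_iff_image:
  assumes "simple_graph K" "simple_graph L"
  shows "graph_iso K L \<longleftrightarrow> (\<exists>g. bij_betw g (verts L) (verts K) \<and> edges K = (`) g ` edges L)"
proof -
  have "graph_iso K L \<longleftrightarrow> graph_iso L K" by (rule iffI; erule graph_iso_sym)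
  also have "\<dots> \<longleftrightarrow> (\<exists>g. bij_betw g (verts L) (verts K) \<and> edges K = (`) g ` edges L)"
    by (simp add: graph_iso_def edges_eq_image_iff[OF assms] cong: conj_cong)
  finally show ?thesis .
qed

lemma graph_iso_card_verts: "graph_iso K L \<Longrightarrow> card (verts K) = card (verts L)"
  by (auto simp: graph_iso_def bij_betw_same_card)

lemma graph_iso_card_edges:
  assumes "simple_graph K" "simple_graph L" "graph_iso K L"
  shows "card (edges K) = card (edges L)"
proof -
  obtain g where g: "bij_betw g (verts L) (verts K)" and "edges K = (`) g ` edges L"
    using assms(3) unfolding graph_iso_iff_image[OF assms(1,2)] by blast
  moreover have "inj_on ((`) g) (edges L)"
    using inj_on_image_Pow[OF bij_betw_imp_inj_on[OF g]] edges_subset_Pow[OF assms(2)]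
    by (rule inj_on_subset)
  ultimately show ?thesis by (simp add: card_image)
qed

definition cyc_suc :: "nat \<Rightarrow> nat \<Rightarrow> nat" where
  "cyc_suc n t = t mod n + 1"

lemma cyc_suc_in_range: "n \<ge> 1 \<Longrightarrow> cyc_suc n t \<in> {1..n}"
  using mod_less_divisor[of n t] by (simp add: cyc_suc_def Suc_le_eq)

lemma verts_cycle_graph [simp]: "verts (cycle_graph n) = {1..n}"
  by (simp add: cycle_graph_def)

lemma edges_cycle_graph:
  assumes "n \<ge> 1"
  shows "edges (cycle_graph n) = (\<lambda>t. {t, cyc_suc n t}) ` {1..n}"
proof -
  have "{{i, i + 1} | i. 1 \<le> i \<and> i < n} = (\<lambda>t. {t, cyc_suc n t}) ` {1..<n}"
    by (force simp: cyc_suc_def image_iff)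
  moreover have "{1..n} = insert n {1..<n}" using assms by auto
  ultimately show ?thesis by (simp add: cycle_graph_def cyc_suc_def)
qed

lemma cyc_suc_cases:
  assumes "t \<in> {1..n}"
  obtains "t < n" "cyc_suc n t = t + 1" | "t = n" "cyc_suc n t = 1"
  using assms by (cases "t = n") (auto simp: cyc_suc_def)

lemma cyc_suc_neq: "n \<ge> 2 \<Longrightarrow> t \<in> {1..n} \<Longrightarrow> cyc_suc n t \<noteq> t"
  by (erule cyc_suc_cases) auto

lemma cyc_suc_asym: "n \<ge> 3 \<Longrightarrow> t \<in> {1..n} \<Longrightarrow> cyc_suc n (cyc_suc n t) \<noteq> t"
  by (erule cyc_suc_cases) (auto simp: cyc_suc_def mod_Suc)

lemma inj_on_cyc_suc_edge:
  assumes "n \<ge> 3" shows "inj_on (\<lambda>t. {t, cyc_suc n t}) {1..n}"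
  using cyc_suc_asym[OF assms] by (fastforce simp: inj_on_def doubleton_eq_iff)

lemma simple_cycle_graph:
  assumes "n \<ge> 3" shows "simple_graph (cycle_graph n)"
proof -
  have "card {t, cyc_suc n t} = 2 \<and> {t, cyc_suc n t} \<subseteq> {1..n}" if "t \<in> {1..n}" for t
    using cyc_suc_neq[OF _ that] cyc_suc_in_range[of n t] that assms by (auto simp: card_2_iff)
  then show ?thesis using assms by (auto simp: simple_graph_def edges_cycle_graph)
qed

lemma card_edges_cycle_graph: "n \<ge> 3 \<Longrightarrow> card (edges (cycle_graph n)) = n"
  using card_image[OF inj_on_cyc_suc_edge] by (simp add: edges_cycle_graph)

lemma bij_betw_cyc_suc:
  assumes "n \<ge> 1" shows "bij_betw (cyc_suc n) {1..n} {1..n}"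
proof -
  have "inj_on (cyc_suc n) {1..n}"
  proof (rule inj_onI)
    fix s t assume s: "s \<in> {1..n}" and t: "t \<in> {1..n}" and "cyc_suc n s = cyc_suc n t"
    then have "s mod n = t mod n" by (simp add: cyc_suc_def)
    then show "s = t" using s t by (cases "s = n"; cases "t = n") auto
  qed
  moreover have "cyc_suc n ` {1..n} \<subseteq> {1..n}" using cyc_suc_in_range[OF assms] by blast
  ultimately show ?thesis by (simp add: bij_betw_def endo_inj_surj)
qed

lemma cyc_suc_edges:
  assumes "n \<ge> 1" shows "(`) (cyc_suc n) ` edges (cycle_graph n) = edges (cycle_graph n)"
proof -
  have "(`) (cyc_suc n) ` edges (cycle_graph n) = (\<lambda>t. {t, cyc_suc n t}) ` cyc_suc n ` {1..n}"
    using assms by (simp add: edges_cycle_graph image_image)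
  also have "cyc_suc n ` {1..n} = {1..n}"
    using bij_betw_cyc_suc[OF assms] by (simp add: bij_betw_def)
  finally show ?thesis using assms by (simp add: edges_cycle_graph)
qed

lemma
  assumes n: "n \<ge> 1"
  shows bij_betw_cyc_suc_funpow: "bij_betw (cyc_suc n ^^ k) {1..n} {1..n}"
    and cyc_suc_funpow_edges:
      "(`) (cyc_suc n ^^ k) ` edges (cycle_graph n) = edges (cycle_graph n)"
    and cyc_suc_funpow_start: "k < n \<Longrightarrow> (cyc_suc n ^^ k) 1 = k + 1"
proof (induction k)
  case (Suc k)
  {
    case 1
    then show ?case
      using bij_betw_trans[OF Suc.IH(1) bij_betw_cyc_suc[OF n]] by (simp only: funpow.simps)
  next
    case 2
    have "(`) (cyc_suc n ^^ Suc k) ` edges (cycle_graph n) =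
        (`) (cyc_suc n) ` (`) (cyc_suc n ^^ k) ` edges (cycle_graph n)"
      by (simp add: image_image image_comp)
    then show ?case using Suc.IH(2) cyc_suc_edges[OF n] by simp
  next
    case 3
    then have "(cyc_suc n ^^ Suc k) 1 = cyc_suc n (k + 1)"
      using Suc.IH(3) by (simp only: funpow.simps comp_apply)
    also have "\<dots> = Suc k + 1" using 3 by (simp add: cyc_suc_def)
    finally show ?case .
  }
qed (simp_all add: bij_betw_def image_image)

lemma graph_iso_cycle_startE:
  assumes "simple_graph K" "graph_iso K (cycle_graph n)" "n \<ge> 3" "x \<in> verts K"
  obtains g where "bij_betw g {1..n} (verts K)" "edges K = (`) g ` edges (cycle_graph n)" "g 1 = x"
proof -
  obtain g where g: "bij_betw g {1..n} (verts K)" "edges K = (`) g ` edges (cycle_graph n)"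
    using assms(2) graph_iso_iff_image[OF assms(1) simple_cycle_graph[OF assms(3)]] by auto
  obtain i where i: "i \<in> {1..n}" "x = g i" using g(1) assms(4) unfolding bij_betw_def by blast
  have n: "n \<ge> 1" using assms(3) by simp
  let ?h = "g \<circ> (cyc_suc n ^^ (i - 1))"
  have "edges K = (`) g ` (`) (cyc_suc n ^^ (i - 1)) ` edges (cycle_graph n)"
    using cyc_suc_funpow_edges[OF n] g(2) by simp
  then have "edges K = (`) ?h ` edges (cycle_graph n)" by (simp add: image_image image_comp)
  moreover have "(cyc_suc n ^^ (i - 1)) 1 = i"
    using cyc_suc_funpow_start[OF n, of "i - 1"] i(1) by auto
  then have "?h 1 = x" using i(2) by simp
  ultimately show ?thesis
    using bij_betw_trans[OF bij_betw_cyc_suc_funpow[OF n] g(1)] by (intro that)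
qed

lemma cyc_suc_switch:
  assumes "i \<in> {1..n}" "j \<in> {1..n}" "P i" "\<not> P j"
  obtains t where "t \<in> {1..n}" "P t" "\<not> P (cyc_suc n t)"
proof -
  have "\<exists>t\<in>{1..n}. P t \<and> \<not> P (cyc_suc n t)"
  proof (rule ccontr)
    assume "\<not> ?thesis"
    then have closed: "P (cyc_suc n t)" if "P t" "t \<in> {1..n}" for t using that by blast
    have n: "n \<ge> 1" using assms(1) by auto
    have orbit: "P ((i + k) mod n + 1)" for k
    proof (induction k)
      case 0 then show ?case using closed[OF assms(3,1)] by (simp add: cyc_suc_def)
    next
      case (Suc k)
      then show ?case
        using closed[of "(i + k) mod n + 1"] cyc_suc_in_range[OF n, of "i + k"]
        by (simp add: cyc_suc_def mod_Suc_eq)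
    qed
    have "i + (n + j - 1 - i) = (j - 1) + n" "(j - 1) mod n + 1 = j" using assms(1,2) by auto
    then show False using orbit[of "n + j - 1 - i"] assms(4) by (metis mod_add_self2)
  qed
  then show ?thesis using that by blast
qed

lemma cycle_cut:
  assumes "simple_graph K" "graph_iso K (cycle_graph n)" "n \<ge> 3"
    and "verts K \<inter> X \<noteq> {}" "verts K - X \<noteq> {}"
  obtains a b c d where "{a, b} \<in> edges K" "{c, d} \<in> edges K" "{a, b} \<noteq> {c, d}"
    "a \<in> X" "b \<notin> X" "c \<in> X" "d \<notin> X"
proof -
  obtain g where g: "bij_betw g {1..n} (verts K)"
    and edges_K: "edges K = (`) g ` edges (cycle_graph n)"
    using assms(1,2) graph_iso_iff_image[OF assms(1) simple_cycle_graph[OF assms(3)]] by auto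
  have step: "{g t, g (cyc_suc n t)} \<in> edges K" if "t \<in> {1..n}" for t
    using that assms(3) by (simp add: edges_K edges_cycle_graph image_image)
  have verts_K: "verts K = g ` {1..n}" using g by (simp add: bij_betw_def)
  obtain i j where i: "i \<in> {1..n}" "g i \<in> X" and j: "j \<in> {1..n}" "g j \<notin> X"
    using assms(4,5) unfolding verts_K by blast
  obtain t where t: "t \<in> {1..n}" "g t \<in> X" "g (cyc_suc n t) \<notin> X"
    using cyc_suc_switch[OF i(1) j(1), of "\<lambda>t. g t \<in> X"] i(2) j(2) by blast
  obtain s where s: "s \<in> {1..n}" "g s \<notin> X" "g (cyc_suc n s) \<in> X"
    using cyc_suc_switch[OF j(1) i(1), of "\<lambda>t. g t \<notin> X"] i(2) j(2) by blast
  have "{g t, g (cyc_suc n t)} \<noteq> {g (cyc_suc n s), g s}"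
  proof
    assume "{g t, g (cyc_suc n t)} = {g (cyc_suc n s), g s}"
    then have "g t = g (cyc_suc n s)" "g s = g (cyc_suc n t)"
      using s t by (auto simp: doubleton_eq_iff)
    then have "t = cyc_suc n s" "s = cyc_suc n t"
      using inj_onD[OF bij_betw_imp_inj_on[OF g]] s(1) t(1) cyc_suc_in_range[of n] assms(3) by auto
    then show False using cyc_suc_asym[OF assms(3) t(1)] by simp
  qed
  then show ?thesis
    using that[of "g t" "g (cyc_suc n t)" "g (cyc_suc n s)" "g s"] s t step[OF s(1)] step[OF t(1)]
    by (simp add: insert_commute)
qed

lemma cycle_degree:
  assumes "simple_graph K" "graph_iso K (cycle_graph n)" "n \<ge> 3" "x \<in> verts K"
  shows "2 \<le> card {y \<in> verts K. {x, y} \<in> edges K}"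
proof -
  have "card (verts K) = n" using graph_iso_card_verts[OF assms(2)] by simp
  then have "verts K - {x} \<noteq> {}" using assms(3) card_mono[of "{x}" "verts K"] by auto
  then obtain a b c d where ab: "{a, b} \<in> edges K" "{c, d} \<in> edges K" "{a, b} \<noteq> {c, d}"
    "a \<in> {x}" "b \<notin> {x}" "c \<in> {x}" "d \<notin> {x}"
    using cycle_cut[OF assms(1-3), of "{x}"] assms(4) by (metis IntI empty_iff insertI1)
  then have "{b, d} \<subseteq> {y \<in> verts K. {x, y} \<in> edges K}"
    using edges_subset_Pow[OF assms(1)] by auto
  moreover have "finite {y \<in> verts K. {x, y} \<in> edges K}"
    using assms(1) by (simp add: simple_graph_def)
  moreover have "b \<noteq> d" using ab by blast
  then have "card {b, d} = 2" by simp
  ultimately show ?thesis by (metis card_mono)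
qed

lemma edges_cycle_graph_4: "edges (cycle_graph 4) = {{1, 2}, {2, 3}, {3, 4}, {4, 1}}"
  and edges_cycle_graph_5: "edges (cycle_graph 5) = {{1, 2}, {2, 3}, {3, 4}, {4, 5}, {5, 1}}"
proof -
  have "{1..4} = {1, 2, 3, 4::nat}" "{1..5} = {1, 2, 3, 4, 5::nat}" by auto
  then show "edges (cycle_graph 4) = {{1, 2}, {2, 3}, {3, 4}, {4, 1}}"
    "edges (cycle_graph 5) = {{1, 2}, {2, 3}, {3, 4}, {4, 5}, {5, 1}}"
    by (simp_all add: edges_cycle_graph cyc_suc_def del: One_nat_def)
qed

lemma simple_diamond_graph: "simple_graph diamond_graph"
  by (auto simp: simple_graph_def diamond_graph_def card_insert_if)

section \<open>Cuts, cycles and components\<close>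

locale finite_simple_graph =
  fixes G :: "'a ugraph"
  assumes simple: "simple_graph G"
begin

text \<open>Induced subgraphs are represented by their vertex sets.\<close>

abbreviation V :: "'a set" where "V \<equiv> verts G"
abbreviation E :: "'a set set" where "E \<equiv> edges G"
abbreviation N :: "'a set \<Rightarrow> 'a set" where "N \<equiv> closed_nbhd_set G"

definition edges_in :: "'a set \<Rightarrow> 'a set set" where
  "edges_in S = {e \<in> E. e \<subseteq> S}"

abbreviation num_edges :: "'a set \<Rightarrow> nat" where
  "num_edges S \<equiv> card (edges_in S)"

definition induced :: "'a set \<Rightarrow> 'a ugraph" where
  "induced S = \<lparr>verts = S, edges = edges_in S\<rparr>"

definition crossing :: "'a set \<Rightarrow> 'a set \<Rightarrow> 'a set set" where
  "crossing X Y = {e \<in> E. \<exists>x\<in>X. \<exists>y\<in>Y. e = {x, y}}"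

definition nbrs :: "'a set \<Rightarrow> 'a \<Rightarrow> 'a set" where
  "nbrs S v = {u \<in> S. {v, u} \<in> E}"

lemma finite_vertex_set: "S \<subseteq> V \<Longrightarrow> finite S"
  using simple finite_subset by (auto simp: simple_graph_def)

lemma edge_subset_V: "e \<in> E \<Longrightarrow> e \<subseteq> V" and card_edge: "e \<in> E \<Longrightarrow> card e = 2"
  using simple by (auto simp: simple_graph_def)

lemma edgeE:
  assumes "e \<in> E" obtains a b where "e = {a, b}" "a \<noteq> b"
  using edge_doubletonE[OF simple assms] by metis

lemma no_loop [simp]: "{x} \<notin> E"
  using card_edge[of "{x}"] by auto

lemma finite_E [simp]: "finite E"
  using edge_subset_V finite_vertex_set[of V]
  by (meson PowI finite_Pow_iff finite_subset subset_refl subsetI)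

lemma finite_edges_in [simp]: "finite (edges_in S)"
  by (simp add: edges_in_def)

lemma finite_crossing [simp]: "finite (crossing X Y)"
  by (simp add: crossing_def)

lemma finite_nbrs: "S \<subseteq> V \<Longrightarrow> finite (nbrs S v)"
  using finite_vertex_set by (simp add: nbrs_def)

lemma induced_simps [simp]: "verts (induced S) = S" "edges (induced S) = edges_in S"
  by (simp_all add: induced_def)

lemma simple_induced: "S \<subseteq> V \<Longrightarrow> simple_graph (induced S)"
  using finite_vertex_set card_edge by (auto simp: simple_graph_def edges_in_def)

lemma mem_N_iff: "u \<in> N D \<longleftrightarrow> u \<in> D \<or> (\<exists>d\<in>D. {d, u} \<in> E)"
  by (auto simp: closed_nbhd_set_def closed_nbhd_def)

lemma N_empty [simp]: "N {} = {}"
  and N_Un: "N (A \<union> B) = N A \<union> N B"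
  and N_mono: "A \<subseteq> B \<Longrightarrow> N A \<subseteq> N B"
  by (auto simp: closed_nbhd_set_def)

lemma mem_edges_in_iff: "{x, y} \<in> edges_in S \<longleftrightarrow> {x, y} \<in> E \<and> x \<in> S \<and> y \<in> S"
  by (auto simp: edges_in_def)

lemma edges_in_mono: "S \<subseteq> S' \<Longrightarrow> edges_in S \<subseteq> edges_in S'"
  and edges_in_Int: "edges_in (A \<inter> B) = edges_in A \<inter> edges_in B"
  by (auto simp: edges_in_def)

lemma edges_in_trivial [simp]: "edges_in {} = {}" "edges_in {x} = {}"
  by (auto simp: edges_in_def subset_singleton_iff dest: card_edge)

lemma crossingI: "{x, y} \<in> E \<Longrightarrow> x \<in> X \<Longrightarrow> y \<in> Y \<Longrightarrow> {x, y} \<in> crossing X Y"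
  by (auto simp: crossing_def)

lemma crossingE:
  assumes "e \<in> crossing X Y" obtains x y where "e = {x, y}" "x \<in> X" "y \<in> Y" "{x, y} \<in> E"
  using assms by (auto simp: crossing_def)

lemma crossing_mono: "X \<subseteq> X' \<Longrightarrow> Y \<subseteq> Y' \<Longrightarrow> crossing X Y \<subseteq> crossing X' Y'"
  unfolding crossing_def by blast

lemma crossing_commute: "crossing X Y = crossing Y X"
  unfolding crossing_def by (auto simp: insert_commute)

lemma crossing_Un: "crossing X (Y \<union> Z) = crossing X Y \<union> crossing X Z"
  by (auto simp: crossing_def)

lemma crossing_disjoint:
  "A \<inter> B = {} \<Longrightarrow> A \<inter> X = {} \<Longrightarrow> B \<inter> X = {} \<Longrightarrow> crossing A X \<inter> crossing B X = {}"
  by (auto simp: crossing_def doubleton_eq_iff)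

lemma crossing_empty [simp]: "crossing {} X = {}"
  by (simp add: crossing_def)

lemma edges_in_Un: "edges_in (A \<union> B) = edges_in A \<union> edges_in B \<union> crossing A B"
proof (intro set_eqI iffI)
  fix e assume "e \<in> edges_in (A \<union> B)"
  moreover from this obtain a b where "e = {a, b}" unfolding edges_in_def by (blast elim: edgeE)
  ultimately show "e \<in> edges_in A \<union> edges_in B \<union> crossing A B"
    by (auto simp: edges_in_def crossing_def insert_commute)
qed (auto simp: edges_in_def crossing_def)

lemma num_edges_Un:
  assumes "A \<inter> B = {}"
  shows "num_edges (A \<union> B) = num_edges A + num_edges B + card (crossing A B)"
proof -
  have "edges_in A \<inter> edges_in B = {}" using assms by (simp flip: edges_in_Int)
  moreover have "(edges_in A \<union> edges_in B) \<inter> crossing A B = {}"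
    using assms by (auto simp: edges_in_def crossing_def)
  ultimately show ?thesis by (simp add: edges_in_Un card_Un_disjoint)
qed

lemma card_crossing_singleton: "card (crossing {v} Y) = card (nbrs Y v)"
proof -
  have "crossing {v} Y = (\<lambda>y. {v, y}) ` nbrs Y v" by (auto simp: crossing_def nbrs_def)
  moreover have "inj_on (\<lambda>y. {v, y}) (nbrs Y v)" by (auto simp: inj_on_def doubleton_eq_iff)
  ultimately show ?thesis by (simp add: card_image)
qed

lemma card_crossing_UN:
  assumes "finite I" "disjoint_family_on A I" "(\<Union>i\<in>I. A i) \<inter> X = {}"
  shows "card (crossing (\<Union>i\<in>I. A i) X) = (\<Sum>i\<in>I. card (crossing (A i) X))"
proof -
  have "crossing (\<Union>i\<in>I. A i) X = (\<Union>i\<in>I. crossing (A i) X)" by (auto simp: crossing_def)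
  moreover have "crossing (A i) X \<inter> crossing (A j) X = {}" if "i \<in> I" "j \<in> I" "i \<noteq> j" for i j
    using assms(2,3) that by (intro crossing_disjoint) (auto simp: disjoint_family_on_def)
  ultimately show ?thesis using assms(1) by (simp add: card_UN_disjoint)
qed

lemma card_UN_crossing_le:
  assumes "A \<inter> B = {}"
  shows "card (\<Union>e\<in>crossing A B. e \<inter> A) \<le> card (crossing A B)"
proof -
  have "card (e \<inter> A) = 1" if "e \<in> crossing A B" for e
  proof -
    obtain a b where "e = {a, b}" "a \<in> A" "b \<in> B" using \<open>e \<in> crossing A B\<close> by (rule crossingE)
    then have "e \<inter> A = {a}" using assms by auto
    then show ?thesis by simp
  qed
  then show ?thesis using card_UN_le[of "crossing A B" "\<lambda>e. e \<inter> A"] by simp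
qed

definition cycle_set :: "nat \<Rightarrow> 'a set \<Rightarrow> bool" where
  "cycle_set k C \<longleftrightarrow> (\<exists>K n. subgraph_of K G \<and> verts K = C \<and> n \<ge> k \<and> graph_iso K (cycle_graph n))"

lemma cycle_setE:
  assumes "cycle_set k C"
  obtains K n where "subgraph_of K G" "simple_graph K" "verts K = C" "n \<ge> k"
    "graph_iso K (cycle_graph n)"
  using assms by (auto simp: cycle_set_def subgraph_of_def)

lemma cycle_set_subset_V: "cycle_set k C \<Longrightarrow> C \<subseteq> V"
  by (auto simp: cycle_set_def subgraph_of_def)

lemma cycle_set_card: "cycle_set k C \<Longrightarrow> k \<le> card C"
  using graph_iso_card_verts by (fastforce elim!: cycle_setE)

lemma no_cycle_in_small_set:
  assumes "finite A" "card A < k" "C \<subseteq> A" shows "\<not> cycle_set k C"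
  using cycle_set_card[of k C] card_mono[OF assms(1,3)] assms(2) by linarith

lemma card_nbrs_cycle:
  assumes "cycle_set k C" "3 \<le> k" "x \<in> C"
  shows "2 \<le> card (nbrs C x)"
proof -
  obtain K n where K: "subgraph_of K G" "simple_graph K" "verts K = C" "n \<ge> k"
    "graph_iso K (cycle_graph n)" using assms(1) by (rule cycle_setE)
  then have "2 \<le> card {y \<in> C. {x, y} \<in> edges K}" using cycle_degree[of K n x] assms(2,3) by simp
  also have "\<dots> \<le> card (nbrs C x)"
    using K(1) finite_nbrs[OF cycle_set_subset_V[OF assms(1)]]
    by (intro card_mono) (auto simp: nbrs_def subgraph_of_def)
  finally show ?thesis .
qed

lemma card_le_num_edges_cycle:
  assumes "cycle_set k C" "3 \<le> k"
  shows "card C \<le> num_edges C"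
proof -
  obtain K n where K: "subgraph_of K G" "simple_graph K" "verts K = C" "n \<ge> k"
    "graph_iso K (cycle_graph n)" using assms(1) by (rule cycle_setE)
  then have "card C = card (edges K)"
    using graph_iso_card_verts[OF K(5)] graph_iso_card_edges[OF K(2) simple_cycle_graph K(5)]
      assms(2)
    by (simp add: card_edges_cycle_graph)
  also have "\<dots> \<le> num_edges C"
    using K(1,3) edges_subset_Pow[OF K(2)]
    by (intro card_mono) (auto simp: edges_in_def subgraph_of_def)
  finally show ?thesis .
qed

lemma cycle_set_separated:
  assumes "cycle_set k C" "3 \<le> k" "card (crossing (C \<inter> X) (C - X)) \<le> 1"
  shows "C \<subseteq> X \<or> C \<inter> X = {}"
proof (rule ccontr)
  assume split: "\<not> ?thesis"
  obtain K n where K: "subgraph_of K G" "simple_graph K" "verts K = C" "n \<ge> k"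
    "graph_iso K (cycle_graph n)" using assms(1) by (rule cycle_setE)
  have "n \<ge> 3" "verts K \<inter> X \<noteq> {}" "verts K - X \<noteq> {}" using K(3,4) assms(2) split by auto
  with cycle_cut[OF K(2,5)] obtain a b c d where
    cut: "{a, b} \<in> edges K" "{c, d} \<in> edges K" "{a, b} \<noteq> {c, d}" "a \<in> X" "b \<notin> X" "c \<in> X" "d \<notin> X"
    by metis
  have "edges K \<subseteq> E" "edges K \<subseteq> Pow C"
    using K(1,3) edges_subset_Pow[OF K(2)] by (auto simp: subgraph_of_def)
  then have "{a, b} \<in> crossing (C \<inter> X) (C - X)" "{c, d} \<in> crossing (C \<inter> X) (C - X)"
    using cut by (auto intro!: crossingI)
  then show False using assms(3) cut(3) by (simp add: card_le_Suc0_iff_eq)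
qed

lemma four_cycle_cycle_set:
  assumes "distinct [a, b, c, d]" "{a, b} \<in> E" "{b, c} \<in> E" "{c, d} \<in> E" "{d, a} \<in> E"
  shows "cycle_set 4 {a, b, c, d}"
proof -
  define K where "K = \<lparr>verts = {a, b, c, d}, edges = {{a, b}, {b, c}, {c, d}, {d, a}}\<rparr>"
  define g :: "nat \<Rightarrow> 'a" where "g i = [a, b, c, d] ! (i - 1)" for i
  have "verts K \<subseteq> V" using assms(2,4) edge_subset_V by (auto simp: K_def)
  then have K: "subgraph_of K G" "simple_graph K"
    using assms by (auto simp: subgraph_of_def simple_graph_def K_def)
  have "{1..4} = {1, 2, 3, 4::nat}" by auto
  then have "bij_betw g (verts (cycle_graph 4)) (verts K)"
    using assms(1) by (simp add: bij_betw_def g_def K_def insert_commute)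
  moreover have "edges K = (`) g ` edges (cycle_graph 4)"
    by (simp add: K_def g_def edges_cycle_graph_4)
  ultimately have "graph_iso K (cycle_graph 4)"
    using graph_iso_iff_image[OF K(2) simple_cycle_graph] by auto
  then show ?thesis
    using K(1) unfolding cycle_set_def K_def by (metis order_refl ugraph.select_convs(1))
qed

definition connected_on :: "'a set \<Rightarrow> bool" where
  "connected_on S \<longleftrightarrow> S \<noteq> {} \<and> (\<forall>X\<subseteq>S. X \<noteq> {} \<longrightarrow> X \<noteq> S \<longrightarrow> crossing X (S - X) \<noteq> {})"

lemma connected_on_nonempty: "connected_on S \<Longrightarrow> S \<noteq> {}"
  by (simp add: connected_on_def)

lemma connected_onE:
  assumes "connected_on S" "X \<subseteq> S" "X \<noteq> {}" "X \<noteq> S"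
  obtains x y where "x \<in> X" "y \<in> S - X" "{x, y} \<in> E"
  using assms unfolding connected_on_def by (metis crossingE ex_in_conv)

lemma connected_on_singleton: "connected_on {y}"
  unfolding connected_on_def by auto

lemma connected_on_Un:
  assumes "connected_on A" "connected_on B" "{x, y} \<in> E" "x \<in> A" "y \<in> B"
  shows "connected_on (A \<union> B)"
  unfolding connected_on_def
proof (intro conjI allI impI)
  fix Z assume Z: "Z \<subseteq> A \<union> B" "Z \<noteq> {}" "Z \<noteq> A \<union> B"
  have split: "crossing Z ((A \<union> B) - Z) \<noteq> {}"
    if K: "connected_on K" "K \<subseteq> A \<union> B" "Z \<inter> K \<noteq> {}" "\<not> K \<subseteq> Z" for K
  proof -
    obtain p q where "p \<in> Z \<inter> K" "q \<in> K - (Z \<inter> K)" "{p, q} \<in> E"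
      using connected_onE[OF K(1), of "Z \<inter> K"] K by blast
    then have "{p, q} \<in> crossing Z ((A \<union> B) - Z)" using K(2) by (intro crossingI) auto
    then show ?thesis by blast
  qed
  consider (A_split) "Z \<inter> A \<noteq> {}" "\<not> A \<subseteq> Z" | (B_split) "Z \<inter> B \<noteq> {}" "\<not> B \<subseteq> Z"
    | (x_only) "x \<in> Z" "y \<notin> Z" | (y_only) "y \<in> Z" "x \<notin> Z"
    using Z assms(4,5) by blast
  then show "crossing Z ((A \<union> B) - Z) \<noteq> {}"
  proof cases
    case x_only
    then have "{x, y} \<in> crossing Z ((A \<union> B) - Z)" using assms by (intro crossingI) auto
    then show ?thesis by blast
  next
    case y_only
    then have "{y, x} \<in> crossing Z ((A \<union> B) - Z)"
      using assms by (intro crossingI) (auto simp: insert_commute)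
    then show ?thesis by blast
  qed (use split assms in auto)
qed (use assms(4) in auto)

text \<open>Growing \<open>X\<close> to \<open>S\<close> vertex by vertex, each new vertex brings a new edge.\<close>

lemma connected_on_num_edges_ge:
  assumes "S \<subseteq> V" "connected_on S" "X \<subseteq> S" "X \<noteq> {}"
  shows "num_edges X + card (S - X) \<le> num_edges S"
  using assms(3,4)
proof (induction "card (S - X)" arbitrary: X)
  case 0
  then have "X = S" using finite_vertex_set[OF assms(1)] by simp
  then show ?case by simp
next
  case (Suc n)
  have "X \<noteq> S" using Suc.hyps(2) by auto
  then obtain x y where xy: "x \<in> X" "y \<in> S - X" "{x, y} \<in> E"
    using connected_onE[OF assms(2)] Suc.prems by metis
  have Diff: "S - X = insert y (S - insert y X)" using xy(2) by auto
  have "crossing X {y} \<noteq> {}" using crossingI[OF xy(3,1), of "{y}"] by auto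
  then have "num_edges X + 1 \<le> num_edges (insert y X)"
    using num_edges_Un[of X "{y}"] xy(2) by (simp add: Suc_le_eq card_gt_0_iff)
  moreover have card_Diff: "card (S - X) = Suc (card (S - insert y X))"
    using Diff finite_vertex_set[OF assms(1)]
    by (metis DiffE card_insert_disjoint finite_Diff insertI1)
  moreover have "num_edges (insert y X) + card (S - insert y X) \<le> num_edges S"
    using Suc.hyps(1)[of "insert y X"] Suc.hyps(2) Suc.prems(1) xy(2) card_Diff by simp
  ultimately show ?case by simp
qed

definition tree_on :: "'a set \<Rightarrow> bool" where
  "tree_on T \<longleftrightarrow> connected_on T \<and> num_edges T + 1 = card T"

lemma tree_on_singleton: "tree_on {x}"
  by (simp add: tree_on_def connected_on_singleton)

lemma tree_on_acyclic:
  assumes "T \<subseteq> V" "tree_on T" "cycle_set k C" "3 \<le> k"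
  shows "\<not> C \<subseteq> T"
proof
  assume "C \<subseteq> T"
  have "C \<noteq> {}" using cycle_set_card[OF assms(3)] assms(4) by auto
  have "card T = card C + card (T - C)"
    using \<open>C \<subseteq> T\<close> finite_vertex_set[OF assms(1)]
    by (simp add: card_Diff_subset finite_subset card_mono)
  also have "\<dots> \<le> num_edges C + card (T - C)" using card_le_num_edges_cycle[OF assms(3,4)] by simp
  also have "\<dots> \<le> num_edges T"
    using assms(1,2) \<open>C \<subseteq> T\<close> \<open>C \<noteq> {}\<close> by (intro connected_on_num_edges_ge) (auto simp: tree_on_def)
  finally show False using assms(2) by (simp add: tree_on_def)
qed

definition components :: "'a set \<Rightarrow> 'a set set \<Rightarrow> bool" where
  "components R P \<longleftrightarrow> \<Union>P = R \<and> finite P \<and> (\<forall>H\<in>P. connected_on H) \<and>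
     pairwise (\<lambda>H H'. H \<inter> H' = {} \<and> crossing H H' = {}) P"

lemma
  assumes "components R P"
  shows components_Union: "\<Union>P = R"
    and finite_components: "finite P"
    and component_connected_on: "\<And>H. H \<in> P \<Longrightarrow> connected_on H"
    and component_subset: "\<And>H. H \<in> P \<Longrightarrow> H \<subseteq> R"
  using assms by (auto simp: components_def)

lemma components_insert:
  assumes "components R P" "connected_on H" "H \<inter> R = {}" "crossing H R = {}"
  shows "components (H \<union> R) (insert H P)"
proof -
  have "H \<inter> H' = {} \<and> crossing H H' = {} \<and> crossing H' H = {}" if "H' \<in> P" for H'
    using component_subset[OF assms(1) that] assms(3,4) crossing_mono[of H H H' R]
      crossing_commute[of H H']
    by auto
  then show ?thesis using assms(1,2) by (auto simp: components_def pairwise_insert)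
qed

lemma components_exist:
  assumes "finite R" shows "\<exists>P. components R P"
  using assms
proof (induction "card R" arbitrary: R rule: less_induct)
  case less
  show ?case
  proof (cases "R = {}")
    case True
    then show ?thesis by (intro exI[of _ "{}"]) (simp add: components_def)
  next
    case False
    then obtain x where "x \<in> R" by blast
    define connected_subsets where "connected_subsets = {H. H \<subseteq> R \<and> connected_on H}"
    have "finite connected_subsets" "{x} \<in> connected_subsets"
      using less.prems \<open>x \<in> R\<close> connected_on_singleton by (auto simp: connected_subsets_def)
    then obtain H where H: "H \<in> connected_subsets"
      and max: "\<And>H'. H' \<in> connected_subsets \<Longrightarrow> H \<subseteq> H' \<Longrightarrow> H' = H"
      using finite_has_maximal2[of connected_subsets "{x}"] by (metis (no_types, lifting))
    have no_edge: "crossing H (R - H) = {}"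
    proof (rule ccontr)
      assume "crossing H (R - H) \<noteq> {}"
      then obtain a b where ab: "a \<in> H" "b \<in> R - H" "{a, b} \<in> E" by (metis crossingE ex_in_conv)
      then have "H \<union> {b} \<in> connected_subsets"
        using H connected_on_Un[OF _ connected_on_singleton, of H a b]
        by (auto simp: connected_subsets_def)
      then show False using max[of "H \<union> {b}"] ab(2) by auto
    qed
    have "H \<subseteq> R" "H \<noteq> {}" using H connected_on_nonempty by (auto simp: connected_subsets_def)
    then have "card (R - H) < card R" using less.prems by (intro psubset_card_mono) auto
    then obtain P where "components (R - H) P" using less.hyps less.prems by blast
    then have "components (H \<union> (R - H)) (insert H P)"
      using H no_edge by (intro components_insert) (auto simp: connected_subsets_def)
    then show ?thesis using \<open>H \<subseteq> R\<close> by (metis Un_Diff_cancel Un_absorb1)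
  qed
qed

context
  fixes R P
  assumes components: "components R P"
begin

lemma components_disjoint: "disjoint_family_on (\<lambda>H. H) P"
  using components by (auto simp: components_def pairwise_def disjoint_family_on_def)

lemma component_no_edge:
  assumes "H \<in> P" "x \<in> H" "y \<in> R - H"
  shows "{x, y} \<notin> E"
proof
  assume "{x, y} \<in> E"
  obtain H' where "H' \<in> P" "y \<in> H'" using components_Union[OF components] assms(3) by blast
  moreover from this have "H \<noteq> H'" using assms(3) by auto
  ultimately have "crossing H H' = {}"
    using components assms(1) by (simp add: components_def pairwise_def)
  then show False using crossingI[OF \<open>{x, y} \<in> E\<close> assms(2) \<open>y \<in> H'\<close>] by simp
qed

lemma component_crossing:
  assumes "H \<in> P" "R = S - X" "X \<subseteq> S"
  shows "crossing H (S - H) = crossing H X"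
proof
  show "crossing H X \<subseteq> crossing H (S - H)"
    using component_subset[OF components assms(1)] assms(2,3) by (intro crossing_mono) auto
  show "crossing H (S - H) \<subseteq> crossing H X"
  proof
    fix e assume "e \<in> crossing H (S - H)"
    then obtain x y where e: "e = {x, y}" "x \<in> H" "y \<in> S - H" "{x, y} \<in> E" by (rule crossingE)
    then have "y \<in> X" using component_no_edge[OF assms(1) e(2), of y] assms(2) by auto
    then show "e \<in> crossing H X" using e by (simp add: crossingI)
  qed
qed

lemma num_edges_components: "num_edges R = (\<Sum>H\<in>P. num_edges H)"
proof -
  have "edges_in R \<subseteq> (\<Union>H\<in>P. edges_in H)"
  proof
    fix e assume "e \<in> edges_in R"
    moreover from this obtain a b where "e = {a, b}" unfolding edges_in_def by (blast elim: edgeE)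
    ultimately have ab: "e = {a, b}" "{a, b} \<in> E" "a \<in> R" "b \<in> R" by (auto simp: edges_in_def)
    obtain H where H: "H \<in> P" "a \<in> H" using ab(3) components_Union[OF components] by blast
    then have "b \<in> H" using component_no_edge[of H a b] ab by auto
    then show "e \<in> (\<Union>H\<in>P. edges_in H)" using ab H by (auto simp: mem_edges_in_iff)
  qed
  moreover have "(\<Union>H\<in>P. edges_in H) \<subseteq> edges_in R"
    using component_subset[OF components] edges_in_mono by blast
  ultimately have "edges_in R = (\<Union>H\<in>P. edges_in H)" by blast
  moreover have "edges_in H \<inter> edges_in H' = {}" if "H \<in> P" "H' \<in> P" "H \<noteq> H'" for H H'
    using disjoint_family_onD[OF components_disjoint that] by (simp flip: edges_in_Int)
  ultimately show ?thesis using finite_components[OF components] by (simp add: card_UN_disjoint)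
qed

lemma card_crossing_components:
  "R \<inter> X = {} \<Longrightarrow> card (crossing R X) = (\<Sum>H\<in>P. card (crossing H X))"
  using card_crossing_UN[OF finite_components[OF components] components_disjoint, of X]
    components_Union[OF components] by simp

lemma num_edges_delete:
  assumes "R = S - X" "X \<subseteq> S"
  shows "num_edges S = num_edges X + (\<Sum>H\<in>P. num_edges H + card (crossing H X))"
proof -
  have "S = X \<union> R" "X \<inter> R = {}" using assms by auto
  then have "num_edges S = num_edges X + num_edges R + card (crossing R X)"
    using num_edges_Un[of X R] by (simp add: crossing_commute)
  then show ?thesis
    using num_edges_components card_crossing_components[of X] assms(1) by (auto simp: sum.distrib)
qed

lemma component_linked:
  assumes "connected_on S" "R = S - X" "X \<subseteq> S" "X \<noteq> {}" "H \<in> P"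
  shows "crossing H X \<noteq> {}"
proof -
  have "H \<subseteq> S" "H \<noteq> {}" "H \<noteq> S"
    using component_connected_on[OF components assms(5)] component_subset[OF components assms(5)]
      assms(2-4) connected_on_nonempty by auto
  then have "crossing H (S - H) \<noteq> {}" using assms(1) unfolding connected_on_def by blast
  then show ?thesis using component_crossing[OF assms(5,2,3)] by simp
qed

end

section \<open>Isolating sets\<close>

definition isolates :: "'a set \<Rightarrow> 'a set \<Rightarrow> bool" where
  "isolates S D \<longleftrightarrow> (\<forall>C. cycle_set 4 C \<longrightarrow> C \<subseteq> S \<longrightarrow> C \<inter> N D \<noteq> {})"

definition isolable :: "'a set \<Rightarrow> nat \<Rightarrow> bool" where
  "isolable S k \<longleftrightarrow> (\<exists>D\<subseteq>S. isolates S D \<and> 6 * card D \<le> k)"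

text \<open>The strict bound \<open>6 \<iota> < m + 1\<close>.\<close>

abbreviation slack :: "'a set \<Rightarrow> bool" where
  "slack S \<equiv> isolable S (num_edges S)"

definition surviving :: "'a set \<Rightarrow> 'a set \<Rightarrow> 'a set \<Rightarrow> 'a set set" where
  "surviving D X Y = {e \<in> crossing X Y. e \<inter> N D = {}}"

lemma isolatesD: "isolates S D \<Longrightarrow> cycle_set 4 C \<Longrightarrow> C \<subseteq> S \<Longrightarrow> C \<inter> N D \<noteq> {}"
  by (simp add: isolates_def)

lemma isolates_mono:
  assumes "isolates S D" "S' \<subseteq> S" "D \<subseteq> D'" shows "isolates S' D'"
  unfolding isolates_def
proof (intro allI impI)
  fix C assume "cycle_set 4 C" "C \<subseteq> S'"
  then have "C \<inter> N D \<noteq> {}" using isolatesD[OF assms(1)] assms(2) by simp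
  then show "C \<inter> N D' \<noteq> {}" using N_mono[OF assms(3)] by blast
qed

lemma isolates_Diff_nbhd:
  assumes "isolates (S - N D) D'" shows "isolates S (D \<union> D')"
  unfolding isolates_def
proof (intro allI impI)
  fix C assume C: "cycle_set 4 C" "C \<subseteq> S"
  have "C \<inter> N D' \<noteq> {}" if "C \<inter> N D = {}" using isolatesD[OF assms C(1)] C(2) that by blast
  then show "C \<inter> N (D \<union> D') \<noteq> {}" by (auto simp: N_Un)
qed

lemma isolates_if_few_left:
  assumes "S \<subseteq> N D \<union> A" "finite A" "card A < 4"
  shows "isolates S D"
  unfolding isolates_def
proof (intro allI impI notI)
  fix C assume "cycle_set 4 C" "C \<subseteq> S" "C \<inter> N D = {}"
  moreover from this have "C \<subseteq> A" using assms(1) by blast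
  ultimately show False using no_cycle_in_small_set[OF assms(2,3)] by blast
qed

lemma isolable_mono: "isolable S k \<Longrightarrow> k \<le> l \<Longrightarrow> isolable S l"
  unfolding isolable_def using order_trans by blast

lemma finite_surviving [simp]: "finite (surviving D X Y)"
  by (simp add: surviving_def)

lemma surviving_antimono: "D \<subseteq> D' \<Longrightarrow> surviving D' X Y \<subseteq> surviving D X Y"
  using N_mono[of D D'] by (auto simp: surviving_def)

lemma surviving_empty: "Y \<subseteq> N D \<Longrightarrow> surviving D X Y = {}"
  by (auto simp: surviving_def crossing_def)

text \<open>A cycle needs two edges to leave a part and return to it, so at most one surviving edge
  at each part does not matter.\<close>

lemma isolates_separated:
  assumes parts: "\<And>H. H \<in> P \<Longrightarrow> isolates H D \<and> card (surviving D H (S - H)) \<le> 1"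
    and rest: "isolates (S - \<Union>P) D"
  shows "isolates S D"
  unfolding isolates_def
proof (intro allI impI notI)
  fix C assume C: "cycle_set 4 C" "C \<subseteq> S" and avoids: "C \<inter> N D = {}"
  have "C \<inter> H = {}" if H: "H \<in> P" for H
  proof -
    have "crossing (C \<inter> H) (C - H) \<subseteq> surviving D H (S - H)"
    proof
      fix e assume "e \<in> crossing (C \<inter> H) (C - H)"
      then obtain x y where "e = {x, y}" "x \<in> C \<inter> H" "y \<in> C - H" "{x, y} \<in> E" by (rule crossingE)
      then show "e \<in> surviving D H (S - H)"
        using C(2) avoids crossingI[of x y H "S - H"] by (auto simp: surviving_def)
    qed
    then have "card (crossing (C \<inter> H) (C - H)) \<le> 1"
      using parts[OF H] card_mono[OF finite_surviving] by (meson order_trans)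
    then have "C \<subseteq> H \<or> C \<inter> H = {}" using cycle_set_separated[OF C(1)] by simp
    then show ?thesis using isolatesD[OF _ C(1)] parts[OF H] avoids by blast
  qed
  then have "C \<subseteq> S - \<Union>P" using C(2) by blast
  then show False using isolatesD[OF rest C(1)] avoids by blast
qed

lemma isolates_components:
  assumes P: "components (S - X) P" and "X \<subseteq> S" "isolates X D"
    and parts: "\<And>H. H \<in> P \<Longrightarrow> isolates H D \<and> card (surviving D H X) \<le> 1"
  shows "isolates S D"
proof (rule isolates_separated)
  have "S - \<Union>P = X" using components_Union[OF P] assms(2) by auto
  then show "isolates (S - \<Union>P) D" using assms(3) by simp
  fix H assume H: "H \<in> P"
  show "isolates H D \<and> card (surviving D H (S - H)) \<le> 1"
    using parts[OF H] component_crossing[OF P H refl assms(2)] by (simp add: surviving_def)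
qed

text \<open>Choose \<open>Z\<close> in \<open>X\<close> and treat the components \<open>H\<close> of the rest separately: the cost of \<open>Z\<close> is
  paid by the edges inside \<open>X\<close> and by the \<open>g H\<close> edges that \<open>H\<close> and its links to \<open>X\<close> leave over.\<close>

lemma slack_by_parts:
  assumes P: "components (S - X) P" and X: "X \<subseteq> S" "Z \<subseteq> X" "isolates X Z"
    and parts: "\<And>H. H \<in> P \<Longrightarrow>
      \<exists>D\<subseteq>H. isolates H (Z \<union> D) \<and> card (surviving (Z \<union> D) H X) \<le> 1 \<and>
        6 * card D + g H \<le> num_edges H + card (crossing H X)"
    and gain: "6 * card Z \<le> num_edges X + (\<Sum>H\<in>P. g H)"
  shows "slack S"
proof -
  define suitable where "suitable H D \<longleftrightarrow> D \<subseteq> H \<and> isolates H (Z \<union> D) \<and>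
    card (surviving (Z \<union> D) H X) \<le> 1 \<and> 6 * card D + g H \<le> num_edges H + card (crossing H X)"
    for H D
  have "\<forall>H\<in>P. \<exists>D. suitable H D" using parts by (auto simp: suitable_def)
  then obtain f where f: "\<forall>H\<in>P. suitable H (f H)" using bchoice by blast
  define D where "D = Z \<union> (\<Union>H\<in>P. f H)"
  have "isolates H D \<and> card (surviving D H X) \<le> 1" if H: "H \<in> P" for H
  proof -
    have sub: "Z \<union> f H \<subseteq> D" using H by (auto simp: D_def)
    have "card (surviving D H X) \<le> card (surviving (Z \<union> f H) H X)"
      using surviving_antimono[OF sub] by (simp add: card_mono)
    then show ?thesis using f H isolates_mono[OF _ order_refl sub] by (auto simp: suitable_def)
  qed
  moreover have "isolates X D" using isolates_mono[OF X(3)] by (simp add: D_def)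
  ultimately have "isolates S D" using isolates_components[OF P X(1)] by simp
  moreover have "D \<subseteq> S" using X f component_subset[OF P] by (fastforce simp: D_def suitable_def)
  moreover have "6 * card D \<le> num_edges S"
  proof -
    have "card D \<le> card Z + (\<Sum>H\<in>P. card (f H))"
      using card_Un_le[of Z "\<Union>H\<in>P. f H"] card_UN_le[OF finite_components[OF P], of f]
      by (simp add: D_def)
    then have "6 * card D \<le> 6 * card Z + (\<Sum>H\<in>P. 6 * card (f H))"
      by (simp flip: sum_distrib_left)
    also have "\<dots> \<le> num_edges X + (\<Sum>H\<in>P. 6 * card (f H) + g H)"
      using gain by (simp add: sum.distrib)
    also have "\<dots> \<le> num_edges X + (\<Sum>H\<in>P. num_edges H + card (crossing H X))"
      using f by (intro add_left_mono sum_mono) (simp add: suitable_def)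
    also have "\<dots> = num_edges S" using num_edges_delete[OF P refl X(1)] by simp
    finally show ?thesis .
  qed
  ultimately show ?thesis unfolding isolable_def by blast
qed

section \<open>Squares, diamonds and pentagons\<close>

abbreviation square :: "'a set \<Rightarrow> bool" where
  "square S \<equiv> graph_iso (induced S) (cycle_graph 4)"

abbreviation pentagon :: "'a set \<Rightarrow> bool" where
  "pentagon S \<equiv> graph_iso (induced S) (cycle_graph 5)"

abbreviation diamond :: "'a set \<Rightarrow> bool" where
  "diamond S \<equiv> graph_iso (induced S) diamond_graph"

lemma simple_induced_if_iso:
  assumes "graph_iso (induced S) L" "simple_graph L"
  shows "simple_graph (induced S)"
proof -
  have "finite S" using assms by (auto simp: graph_iso_def simple_graph_def dest: bij_betw_finite)
  then show ?thesis using card_edge by (auto simp: simple_graph_def edges_in_def)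
qed

lemma square_card: "square S \<Longrightarrow> card S = 4"
  and pentagon_card: "pentagon S \<Longrightarrow> card S = 5"
  and diamond_card: "diamond S \<Longrightarrow> card S = 4"
  by (drule graph_iso_card_verts, simp add: diamond_graph_def)+

lemma induced_iso_num_edges:
  "graph_iso (induced S) L \<Longrightarrow> simple_graph L \<Longrightarrow> num_edges S = card (edges L)"
  using graph_iso_card_edges simple_induced_if_iso by fastforce

lemma square_num_edges: "square S \<Longrightarrow> num_edges S = 4"
  and pentagon_num_edges: "pentagon S \<Longrightarrow> num_edges S = 5"
  by (simp_all add: induced_iso_num_edges simple_cycle_graph card_edges_cycle_graph)

lemma diamond_num_edges: "diamond S \<Longrightarrow> num_edges S = 5"
  using induced_iso_num_edges[OF _ simple_diamond_graph]
  by (simp add: diamond_graph_def card_insert_if doubleton_eq_iff)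

lemma induced_cycle_cycle_set:
  "S \<subseteq> V \<Longrightarrow> graph_iso (induced S) (cycle_graph n) \<Longrightarrow> k \<le> n \<Longrightarrow> cycle_set k S"
  unfolding cycle_set_def
  by (intro exI[of _ "induced S"] exI[of _ n])
    (simp add: subgraph_of_def simple_induced edges_in_def)

lemma square_vertexE:
  assumes "square S" "x \<in> S"
  obtains a b c where "S = {x, a, b, c}" "distinct [x, a, b, c]"
    "edges_in S = {{x, a}, {a, b}, {b, c}, {c, x}}"
proof -
  have simple_S: "simple_graph (induced S)"
    using assms(1) by (simp add: simple_induced_if_iso simple_cycle_graph)
  have x: "x \<in> verts (induced S)" using assms(2) by simp
  obtain g where "bij_betw g {1..4} (verts (induced S))"
    "edges (induced S) = (`) g ` edges (cycle_graph 4)" "g 1 = x"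
    by (rule graph_iso_cycle_startE[OF simple_S assms(1) _ x]) simp
  moreover have "{1..4} = {1, 2, 3, 4::nat}" by auto
  ultimately show ?thesis
    using that[of "g 2" "g 3" "g 4"] by (simp add: edges_cycle_graph_4 bij_betw_def)
qed

lemma pentagon_vertexE:
  assumes "pentagon S" "x \<in> S"
  obtains a b c d where "S = {x, a, b, c, d}" "distinct [x, a, b, c, d]"
    "edges_in S = {{x, a}, {a, b}, {b, c}, {c, d}, {d, x}}"
proof -
  have simple_S: "simple_graph (induced S)"
    using assms(1) by (simp add: simple_induced_if_iso simple_cycle_graph)
  have x: "x \<in> verts (induced S)" using assms(2) by simp
  obtain g where "bij_betw g {1..5} (verts (induced S))"
    "edges (induced S) = (`) g ` edges (cycle_graph 5)" "g 1 = x"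
    by (rule graph_iso_cycle_startE[OF simple_S assms(1) _ x]) simp
  moreover have "{1..5} = {1, 2, 3, 4, 5::nat}" by auto
  ultimately show ?thesis
    using that[of "g 2" "g 3" "g 4" "g 5"] by (simp add: edges_cycle_graph_5 bij_betw_def)
qed

lemma diamondE:
  assumes "diamond S"
  obtains a b c d where "S = {a, b, c, d}" "distinct [a, b, c, d]"
    "edges_in S = {{a, b}, {b, c}, {c, d}, {d, a}, {a, c}}"
proof -
  have "simple_graph (induced S)"
    using assms by (simp add: simple_induced_if_iso simple_diamond_graph)
  from graph_iso_iff_image[OF this simple_diamond_graph] obtain g where
    "bij_betw g (verts diamond_graph) S" "edges_in S = (`) g ` edges diamond_graph"
    using assms by auto
  then show ?thesis
    using that[of "g 1" "g 2" "g 3" "g 4"] by (simp add: diamond_graph_def bij_betw_def)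
qed

lemma diamond_fan:
  assumes "distinct [v, a, b, c]" "{v, a} \<in> E" "{v, b} \<in> E" "{v, c} \<in> E"
    and "edges_in {a, b, c} = {{a, b}, {b, c}}"
  shows "diamond {v, a, b, c}"
proof -
  let ?S = "{v, a, b, c}"
  define g where "g i = [v, a, b, c] ! (i - 1)" for i :: nat
  have "crossing {v} {a, b, c} = {{v, a}, {v, b}, {v, c}}" using assms by (auto simp: crossing_def)
  then have "edges_in ?S = {{v, a}, {a, b}, {b, c}, {c, v}, {v, b}}"
    using edges_in_Un[of "{v}" "{a, b, c}"] assms(5) by (auto simp: insert_commute)
  then have "edges_in ?S = (`) g ` edges diamond_graph" by (simp add: diamond_graph_def g_def)
  moreover have "bij_betw g (verts diamond_graph) ?S"
    using assms(1) by (auto simp: bij_betw_def g_def diamond_graph_def)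
  moreover have "simple_graph (induced ?S)"
    using card_edge by (auto simp: simple_graph_def edges_in_def)
  ultimately show ?thesis
    using graph_iso_iff_image[of "induced ?S", OF _ simple_diamond_graph]
    by (simp only: induced_simps) blast
qed

lemma diamond_cycle_set: "diamond S \<Longrightarrow> cycle_set 4 S"
  by (erule diamondE, simp only:, rule four_cycle_cycle_set) (auto simp: edges_in_def)

lemma diamond_dominating_vertex:
  assumes "diamond S" obtains z where "z \<in> S" "S \<subseteq> N {z}"
proof -
  obtain a b c d where S: "S = {a, b, c, d}"
    and edges: "edges_in S = {{a, b}, {b, c}, {c, d}, {d, a}, {a, c}}"
    using assms by (rule diamondE)
  have "{a, b} \<in> E" "{a, c} \<in> E" "{a, d} \<in> E" using edges by (auto simp: edges_in_def)
  then show ?thesis using that[of a] S by (auto simp: mem_N_iff)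
qed

lemma square_isolates:
  assumes "square S" "S \<inter> N D \<noteq> {}" shows "isolates S D"
proof -
  obtain x where "x \<in> S" "x \<in> N D" using assms(2) by blast
  moreover have "card S = 4" "finite S"
    using square_card[OF assms(1)] card_ge_0_finite[of S] by simp_all
  ultimately show ?thesis by (intro isolates_if_few_left[of _ _ "S - {x}"]) auto
qed

lemma linked_square_isolates:
  assumes "square S" "crossing S {y} \<noteq> {}" shows "isolates S {y}"
proof -
  obtain z where "z \<in> S" "{z, y} \<in> E" using assms(2) by (auto simp: crossing_def)
  then show ?thesis
    using assms(1) by (intro square_isolates) (auto simp: mem_N_iff insert_commute)
qed

lemma diamond_Diff_isolates:
  assumes "diamond S" "u \<in> S" shows "isolates (S - {u}) {}"
  using diamond_card[OF assms(1)] assms(2) card_ge_0_finite[of S]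
  by (intro isolates_if_few_left[of _ _ "S - {u}"]) auto

lemma pentagon_Diff_isolates:
  assumes "pentagon S" "u \<in> S" shows "isolates (S - {u}) {}"
  unfolding isolates_def
proof (intro allI impI)
  fix C assume C: "cycle_set 4 C" "C \<subseteq> S - {u}"
  obtain a b c d where S: "S = {u, a, b, c, d}" "distinct [u, a, b, c, d]"
    and edges: "edges_in S = {{u, a}, {a, b}, {b, c}, {c, d}, {d, u}}"
    using assms by (rule pentagon_vertexE)
  have "a \<notin> C"
  proof
    assume "a \<in> C"
    have "nbrs C a \<subseteq> {b}"
    proof
      fix y assume "y \<in> nbrs C a"
      then have "{a, y} \<in> edges_in S" "y \<noteq> u"
        using C(2) S(1) by (auto simp: nbrs_def mem_edges_in_iff)
      then show "y \<in> {b}" using S(2) unfolding edges by (auto simp: doubleton_eq_iff)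
    qed
    then have "card (nbrs C a) \<le> 1" using card_mono[of "{b}"] by simp
    then show False using card_nbrs_cycle[OF C(1) _ \<open>a \<in> C\<close>] by simp
  qed
  then have "C \<subseteq> {b, c, d}" using C(2) S(1) by auto
  moreover have "card {b, c, d} < 4" by (simp add: card_insert_if)
  ultimately have False using no_cycle_in_small_set[of "{b, c, d}" 4 C] C(1) by simp
  then show "C \<inter> N {} \<noteq> {}" ..
qed

section \<open>Extremal graphs\<close>

definition pendant_square :: "'a \<Rightarrow> 'a set \<Rightarrow> bool" where
  "pendant_square t B \<longleftrightarrow> t \<in> B \<and> square (B - {t}) \<and> card (crossing {t} (B - {t})) = 1"

text \<open>The pure special graphs of the statement: the constituents \<open>B t\<close> are indexed by the vertices
  \<open>t\<close> of the tree instead of by numbers.\<close>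

definition pure_special :: "'a set \<Rightarrow> 'a set \<Rightarrow> ('a \<Rightarrow> 'a set) \<Rightarrow> bool" where
  "pure_special S T B \<longleftrightarrow> tree_on T \<and> S = (\<Union>t\<in>T. B t) \<and> disjoint_family_on B T \<and>
     (\<forall>t\<in>T. pendant_square t (B t)) \<and> edges_in S \<subseteq> edges_in T \<union> (\<Union>t\<in>T. edges_in (B t))"

definition extremal :: "'a set \<Rightarrow> bool" where
  "extremal S \<longleftrightarrow> (\<exists>T B. pure_special S T B) \<or> diamond S \<or> pentagon S"

definition hub :: "'a set \<Rightarrow> 'a \<Rightarrow> bool" where
  "hub S u \<longleftrightarrow> (\<exists>T B. pure_special S T B \<and> u \<in> T)"

lemma pendant_square_num_edges:
  assumes "pendant_square t B" shows "num_edges B = 5"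
proof -
  have "B = {t} \<union> (B - {t})" using assms by (auto simp: pendant_square_def)
  then have "num_edges B = num_edges (B - {t}) + card (crossing {t} (B - {t}))"
    using num_edges_Un[of "{t}" "B - {t}"] by simp
  then show ?thesis using assms square_num_edges by (simp add: pendant_square_def)
qed

lemma pendant_square_attachmentE:
  assumes "pendant_square t B"
  obtains w where "w \<in> B - {t}" "{t, w} \<in> E" "crossing {t} (B - {t}) = {{t, w}}"
proof -
  obtain e where "crossing {t} (B - {t}) = {e}"
    using assms by (auto simp: pendant_square_def card_1_singleton_iff)
  moreover from this obtain w where "e = {t, w}" "w \<in> B - {t}" "{t, w} \<in> E"
    by (metis crossingE insertI1 singletonD)
  ultimately show ?thesis using that[of w] by simp
qed

lemma
  assumes "pure_special S T B"
  shows pure_special_tree: "tree_on T"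
    and pure_special_cover: "S = (\<Union>t\<in>T. B t)"
    and pure_special_disjoint: "disjoint_family_on B T"
    and pure_special_pendant: "\<And>t. t \<in> T \<Longrightarrow> pendant_square t (B t)"
    and pure_special_edges: "edges_in S \<subseteq> edges_in T \<union> (\<Union>t\<in>T. edges_in (B t))"
    and constituent_subset: "\<And>t. t \<in> T \<Longrightarrow> B t \<subseteq> S"
    and hubs_subset: "T \<subseteq> S"
  using assms by (auto simp: pure_special_def pendant_square_def)

context
  fixes S T B
  assumes S_V: "S \<subseteq> V" and pure: "pure_special S T B"
begin

lemma finite_hubs: "finite T"
  using finite_vertex_set[OF S_V] hubs_subset[OF pure] finite_subset by blast

lemma constituent_Int_hubs:
  assumes "t \<in> T" shows "B t \<inter> T = {t}"
proof -
  have hub_mem: "s \<in> B s" if "s \<in> T" for s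
    using pure_special_pendant[OF pure that] by (simp add: pendant_square_def)
  have "s = t" if "s \<in> B t" "s \<in> T" for s
    using disjoint_family_onD[OF pure_special_disjoint[OF pure] that(2) assms] hub_mem that by blast
  then show ?thesis using hub_mem assms by blast
qed

lemma pure_special_edges_in: "edges_in S = edges_in T \<union> (\<Union>t\<in>T. edges_in (B t))"
  using pure_special_edges[OF pure] constituent_subset[OF pure] hubs_subset[OF pure]
    edges_in_mono[of _ S] by blast

lemma pure_special_num_edges: "num_edges S + 1 = 6 * card T"
proof -
  have "edges_in T \<inter> edges_in (B t) = {}" if "t \<in> T" for t
    using constituent_Int_hubs[OF that] by (simp flip: edges_in_Int add: Int_commute)
  then have "edges_in T \<inter> (\<Union>t\<in>T. edges_in (B t)) = {}" by blast
  then have "num_edges S = num_edges T + card (\<Union>t\<in>T. edges_in (B t))"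
    using finite_hubs by (simp add: pure_special_edges_in card_Un_disjoint)
  also have "card (\<Union>t\<in>T. edges_in (B t)) = (\<Sum>t\<in>T. num_edges (B t))"
    using finite_hubs disjoint_family_onD[OF pure_special_disjoint[OF pure]]
    by (intro card_UN_disjoint) (simp_all flip: edges_in_Int)
  also have "\<dots> = (\<Sum>t\<in>T. 5)"
    by (intro sum.cong refl pendant_square_num_edges[OF pure_special_pendant[OF pure]])
  finally show ?thesis using pure_special_tree[OF pure] by (simp add: tree_on_def)
qed

lemma constituent_square_crossing:
  assumes "t \<in> T"
  shows "crossing (B t - {t}) (S - (B t - {t})) = crossing (B t - {t}) {t}"
proof
  have t: "t \<in> B t" "t \<in> S" "B t \<subseteq> S"
    using pure_special_pendant[OF pure assms] constituent_subset[OF pure assms] hubs_subset[OF pure]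
      assms by (auto simp: pendant_square_def)
  then show "crossing (B t - {t}) {t} \<subseteq> crossing (B t - {t}) (S - (B t - {t}))"
    by (intro crossing_mono) auto
  show "crossing (B t - {t}) (S - (B t - {t})) \<subseteq> crossing (B t - {t}) {t}"
  proof
    fix e assume "e \<in> crossing (B t - {t}) (S - (B t - {t}))"
    then obtain x y where e: "e = {x, y}" "x \<in> B t - {t}" "y \<in> S - (B t - {t})" "{x, y} \<in> E"
      by (rule crossingE)
    have "x \<notin> T" using constituent_Int_hubs[OF assms] e(2) by blast
    moreover have "{x, y} \<in> edges_in S" using e t(3) by (auto simp: mem_edges_in_iff)
    then have "{x, y} \<in> edges_in T \<union> (\<Union>s\<in>T. edges_in (B s))"
      using pure_special_edges[OF pure] by blast
    ultimately obtain s where s: "s \<in> T" "x \<in> B s" "y \<in> B s" by (auto simp: mem_edges_in_iff)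
    then have "s = t"
      using disjoint_family_onD[OF pure_special_disjoint[OF pure] _ assms] e(2) by blast
    then have "y = t" using s(3) e(3) by blast
    then show "e \<in> crossing (B t - {t}) {t}" using e crossingI by auto
  qed
qed

lemma pure_special_long_cycleE:
  assumes C: "cycle_set 4 C" "C \<subseteq> S"
  obtains t where "t \<in> T" "C = B t - {t}"
proof -
  have separated: "C \<subseteq> B t - {t} \<or> C \<inter> (B t - {t}) = {}" if t: "t \<in> T" for t
  proof (rule cycle_set_separated[OF C(1)])
    have "crossing (C \<inter> (B t - {t})) (C - (B t - {t})) \<subseteq> crossing {t} (B t - {t})"
      using crossing_mono[of "C \<inter> (B t - {t})" "B t - {t}" "C - (B t - {t})" "S - (B t - {t})"] C(2)
      unfolding constituent_square_crossing[OF t] crossing_commute[of "{t}"] by blast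
    then show "card (crossing (C \<inter> (B t - {t})) (C - (B t - {t}))) \<le> 1"
      using card_mono[of "crossing {t} (B t - {t})"] pure_special_pendant[OF pure t]
      by (simp add: pendant_square_def)
  qed simp
  have "\<not> C \<subseteq> T"
    using tree_on_acyclic[OF _ pure_special_tree[OF pure] C(1)] hubs_subset[OF pure] S_V
    by simp
  then obtain c where "c \<in> C" "c \<notin> T" by blast
  then obtain t where t: "t \<in> T" "c \<in> B t - {t}" using C(2) pure_special_cover[OF pure] by blast
  then have "C \<subseteq> B t - {t}" using separated \<open>c \<in> C\<close> by blast
  moreover have "card (B t - {t}) = 4"
    using pure_special_pendant[OF pure t(1)] square_card by (simp add: pendant_square_def)
  moreover from this have "finite (B t - {t})" by (intro card_ge_0_finite) simp
  ultimately have "C = B t - {t}" using card_seteq[of "B t - {t}" C] cycle_set_card[OF C(1)] by simp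
  then show ?thesis using that t(1) by blast
qed

lemma pure_special_isolates:
  assumes "R \<subseteq> S" "\<And>t. t \<in> T \<Longrightarrow> B t - {t} \<subseteq> R \<Longrightarrow> t \<in> D"
  shows "isolates R D"
  unfolding isolates_def
proof (intro allI impI)
  fix C assume C: "cycle_set 4 C" "C \<subseteq> R"
  obtain t where t: "t \<in> T" "C = B t - {t}"
    using pure_special_long_cycleE[OF C(1)] C(2) assms(1) by blast
  obtain w where "w \<in> B t - {t}" "{t, w} \<in> E"
    using pure_special_pendant[OF pure t(1)] by (rule pendant_square_attachmentE)
  moreover have "t \<in> D" using assms(2) t C(2) by blast
  ultimately have "w \<in> C \<inter> N D" using t(2) by (auto simp: mem_N_iff)
  then show "C \<inter> N D \<noteq> {}" by blast
qed

lemma pure_special_Diff: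
  assumes "u \<in> S" "u \<notin> T"
  obtains D where "D \<subseteq> S - {u}" "isolates (S - {u}) D" "6 * card D + 5 = num_edges S"
proof -
  obtain t where t: "t \<in> T" "u \<in> B t - {t}" using assms pure_special_cover[OF pure] by blast
  have "isolates (S - {u}) (T - {t})"
    using t by (intro pure_special_isolates) auto
  moreover have "6 * card (T - {t}) + 5 = num_edges S"
    using pure_special_num_edges card.remove[OF finite_hubs t(1)] by simp
  moreover have "T - {t} \<subseteq> S - {u}" using hubs_subset[OF pure] assms(2) by blast
  ultimately show ?thesis using that by blast
qed

end

lemma extremal_Diff:
  assumes "S \<subseteq> V" "extremal S" "u \<in> S" "\<not> hub S u"
  obtains D where "D \<subseteq> S - {u}" "isolates (S - {u}) D" "6 * card D + 5 = num_edges S"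
proof -
  consider (pure) T B where "pure_special S T B" "u \<notin> T"
    | (diamond) "diamond S" | (pentagon) "pentagon S"
    using assms(2,4) by (auto simp: extremal_def hub_def)
  then show ?thesis
  proof cases
    case pure
    then show ?thesis using pure_special_Diff[OF assms(1) pure(1) assms(3)] that by blast
  next
    case diamond
    then show ?thesis
      using that[of "{}"] diamond_Diff_isolates[OF diamond assms(3)] diamond_num_edges by simp
  next
    case pentagon
    then show ?thesis
      using that[of "{}"] pentagon_Diff_isolates[OF pentagon assms(3)] pentagon_num_edges by simp
  qed
qed

lemma extremal_through:
  assumes "S \<subseteq> V" "extremal S" "u \<in> S"
  obtains D where "D \<subseteq> S" "u \<in> D" "isolates S D" "6 * card D = num_edges S + 1"
proof (cases "hub S u")
  case True
  then obtain T B where pure: "pure_special S T B" and "u \<in> T" by (auto simp: hub_def)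
  have "isolates S T" by (rule pure_special_isolates[OF assms(1) pure]) auto
  then show ?thesis
    using that[of T] hubs_subset[OF pure] \<open>u \<in> T\<close> pure_special_num_edges[OF assms(1) pure] by simp
next
  case False
  with extremal_Diff[OF assms] obtain D
    where D: "D \<subseteq> S - {u}" "isolates (S - {u}) D" "6 * card D + 5 = num_edges S" by metis
  have "S - N {u} \<subseteq> S - {u}" by (auto simp: mem_N_iff)
  then have "isolates S ({u} \<union> D)" using isolates_mono[OF D(2)] by (intro isolates_Diff_nbhd) auto
  moreover have "card ({u} \<union> D) = card D + 1"
    using D(1) finite_vertex_set[OF assms(1)] finite_subset[of D S]
    by (simp add: card_insert_if subset_Diff_insert)
  ultimately show ?thesis using that[of "{u} \<union> D"] D assms(3) by auto
qed

lemma extremal_nonempty: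
  assumes "extremal S" shows "S \<noteq> {}"
proof -
  have "S \<noteq> {}" if "pure_special S T B" for T B
    using hubs_subset[OF that] pure_special_tree[OF that] connected_on_nonempty
    by (auto simp: tree_on_def)
  then show ?thesis using assms diamond_card pentagon_card by (fastforce simp: extremal_def)
qed

text \<open>The number of edges by which the cost of isolating a component may exceed \<open>num_edges S\<close>.\<close>

definition excess :: "'a set \<Rightarrow> nat" where
  "excess S = (if slack S then 0 else if extremal S then 1 else 2)"

definition classified :: "'a set \<Rightarrow> bool" where
  "classified S \<longleftrightarrow> square S \<or> slack S \<or> extremal S"

lemma extremal_isolable:
  assumes "S \<subseteq> V" "extremal S" shows "isolable S (num_edges S + 1)"
proof -
  obtain u where "u \<in> S" using extremal_nonempty[OF assms(2)] by blast
  then obtain D where "D \<subseteq> S" "isolates S D" "6 * card D = num_edges S + 1"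
    using extremal_through[OF assms] by metis
  then show ?thesis unfolding isolable_def by (metis order_refl)
qed

lemma slack_or_extremal_isolable:
  assumes "S \<subseteq> V" "slack S \<or> extremal S" shows "isolable S (num_edges S + 1)"
  using assms(2)
proof
  assume "slack S"
  then show ?thesis by (rule isolable_mono) simp
qed (rule extremal_isolable[OF assms(1)])

lemma square_isolable:
  assumes "square S" shows "isolable S (num_edges S + 2)"
proof -
  obtain u where "u \<in> S" using square_card[OF assms] by fastforce
  then have "isolates S {u}" using assms by (intro square_isolates) (auto simp: mem_N_iff)
  then show ?thesis
    using \<open>u \<in> S\<close> square_num_edges[OF assms] unfolding isolable_def by (intro exI[of _ "{u}"]) simp
qed

lemma classified_isolable:
  "S \<subseteq> V \<Longrightarrow> classified S \<Longrightarrow> isolable S (num_edges S + excess S)"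
  using extremal_isolable square_isolable by (auto simp: classified_def excess_def)

section \<open>Bridges\<close>

definition bridge :: "'a set \<Rightarrow> 'a set \<Rightarrow> 'a \<Rightarrow> 'a \<Rightarrow> bool" where
  "bridge A B x y \<longleftrightarrow> A \<inter> B = {} \<and> x \<in> A \<and> y \<in> B \<and> crossing A B = {{x, y}}"

lemma bridgeE:
  assumes "A \<inter> B = {}" "card (crossing A B) = 1"
  obtains x y where "bridge A B x y"
proof -
  obtain e where "crossing A B = {e}" using assms(2) by (rule card_1_singletonE)
  moreover from this obtain x y where "e = {x, y}" "x \<in> A" "y \<in> B" by (metis crossingE insertI1)
  ultimately show ?thesis using that assms(1) by (simp add: bridge_def)
qed

lemma bridge_commute: "bridge A B x y \<Longrightarrow> bridge B A y x"
  using crossing_commute[of A B] by (auto simp: bridge_def insert_commute)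

lemma bridge_edge: "bridge A B x y \<Longrightarrow> {x, y} \<in> E"
  by (auto simp: bridge_def crossing_def)

lemma bridge_subset:
  assumes "bridge A B x y" "A' \<subseteq> A" "B' \<subseteq> B" "x \<in> A'" "y \<in> B'"
  shows "bridge A' B' x y"
  using assms crossing_mono[OF assms(2,3)] crossingI[OF bridge_edge[OF assms(1)] assms(4,5)]
  by (auto simp: bridge_def)

lemma bridge_num_edges: "bridge A B x y \<Longrightarrow> num_edges (A \<union> B) = num_edges A + num_edges B + 1"
  by (simp add: bridge_def num_edges_Un)

lemma bridge_connected_on:
  assumes bridge: "bridge A B x y" and conn: "connected_on (A \<union> B)"
  shows "connected_on A"
proof -
  have leaves: "crossing Z (A - Z) \<noteq> {}" if Z: "Z \<subseteq> A" "Z \<noteq> {}" "x \<notin> Z" for Z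
  proof -
    have "Z \<noteq> A \<union> B" using Z bridge by (auto simp: bridge_def)
    then obtain p q where pq: "p \<in> Z" "q \<in> (A \<union> B) - Z" "{p, q} \<in> E"
      using connected_onE[OF conn, of Z] Z by blast
    have "q \<notin> B"
    proof
      assume "q \<in> B"
      then have "{p, q} = {x, y}"
        using crossingI[of p q A B] pq Z(1) bridge by (auto simp: bridge_def)
      then show False using pq(1) Z bridge by (auto simp: bridge_def doubleton_eq_iff)
    qed
    then show ?thesis using crossingI[of p q Z "A - Z"] pq by blast
  qed
  have "crossing Z (A - Z) \<noteq> {}" if Z: "Z \<subseteq> A" "Z \<noteq> {}" "Z \<noteq> A" for Z
  proof (cases "x \<in> Z")
    case True
    have "A - (A - Z) = Z" using Z(1) by auto
    then show ?thesis using leaves[of "A - Z"] Z True crossing_commute[of Z "A - Z"] by auto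
  qed (use leaves Z in auto)
  then show ?thesis using bridge unfolding connected_on_def bridge_def by blast
qed

lemma bridge_components:
  assumes "bridge A B x y" "connected_on (A \<union> B)" "components (B - {y}) Q"
  shows "components (A \<union> B - {y}) (insert A Q)"
proof -
  have xy: "x \<in> A" "y \<in> B" "A \<inter> B = {}" "crossing A B = {{x, y}}"
    using assms(1) by (auto simp: bridge_def)
  have "crossing A (B - {y}) = {}"
  proof (rule equals0I)
    fix e assume "e \<in> crossing A (B - {y})"
    then obtain p q where pq: "p \<in> A" "q \<in> B - {y}" "{p, q} \<in> E" by (rule crossingE)
    then have "{p, q} = {x, y}" using crossingI[of p q A B] xy(4) by simp
    then show False using pq xy(1,3) by (auto simp: doubleton_eq_iff)
  qed
  then have "components (A \<union> (B - {y})) (insert A Q)"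
    using bridge_connected_on[OF assms(1,2)] xy(3) by (intro components_insert[OF assms(3)]) auto
  moreover have "A \<union> (B - {y}) = A \<union> B - {y}" using xy by auto
  ultimately show ?thesis by simp
qed

lemma bridge_isolates:
  assumes "bridge A B x y" "isolates A D" "isolates B D"
  shows "isolates (A \<union> B) D"
proof (rule isolates_separated[of "{A}"])
  have Diff: "A \<union> B - A = B" using assms(1) by (auto simp: bridge_def)
  then show "isolates (A \<union> B - \<Union>{A}) D" using assms(3) by simp
  fix H assume "H \<in> {A}"
  moreover have "surviving D A B \<subseteq> {{x, y}}" using assms(1) by (auto simp: surviving_def bridge_def)
  then have "card (surviving D A B) \<le> 1" using card_mono[of "{{x, y}}"] by simp
  ultimately show "isolates H D \<and> card (surviving D H (A \<union> B - H)) \<le> 1"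
    using assms(2) Diff by simp
qed

lemma bridge_isolable:
  assumes "bridge A B x y" "isolable A j" "isolable B k"
  shows "isolable (A \<union> B) (j + k)"
proof -
  obtain DA where DA: "DA \<subseteq> A" "isolates A DA" "6 * card DA \<le> j"
    using assms(2) by (auto simp: isolable_def)
  obtain DB where DB: "DB \<subseteq> B" "isolates B DB" "6 * card DB \<le> k"
    using assms(3) by (auto simp: isolable_def)
  have "isolates (A \<union> B) (DA \<union> DB)"
    using assms(1) isolates_mono[OF DA(2)] isolates_mono[OF DB(2)] by (intro bridge_isolates) auto
  moreover have "6 * card (DA \<union> DB) \<le> j + k" using card_Un_le[of DA DB] DA(3) DB(3) by simp
  moreover have "DA \<union> DB \<subseteq> A \<union> B" using DA(1) DB(1) by auto
  ultimately show ?thesis unfolding isolable_def by blast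
qed

lemma bridge_non_hub_slack:
  assumes V: "A \<union> B \<subseteq> V" and bridge: "bridge A B x y"
    and extremal: "extremal A" "extremal B" and "\<not> hub A x"
  shows "slack (A \<union> B)"
proof -
  have xy: "x \<in> A" "y \<in> B" using bridge by (auto simp: bridge_def)
  obtain DA where DA: "DA \<subseteq> A - {x}" "isolates (A - {x}) DA" "6 * card DA + 5 = num_edges A"
    using extremal_Diff[OF _ extremal(1) xy(1)] V assms(5) by auto
  obtain DB where DB: "DB \<subseteq> B" "y \<in> DB" "isolates B DB" "6 * card DB = num_edges B + 1"
    using extremal_through[OF _ extremal(2) xy(2)] V by auto
  have "x \<in> N DB" using bridge_edge[OF bridge] DB(2) by (auto simp: mem_N_iff insert_commute)
  then have "isolates (A - N DB) DA" by (intro isolates_mono[OF DA(2)]) auto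
  then have "isolates A (DB \<union> DA)" by (rule isolates_Diff_nbhd)
  moreover have "isolates B (DB \<union> DA)" using isolates_mono[OF DB(3)] by simp
  ultimately have "isolates (A \<union> B) (DB \<union> DA)" using bridge_isolates[OF bridge] by simp
  moreover have "6 * card (DB \<union> DA) \<le> num_edges (A \<union> B)"
    using card_Un_le[of DB DA] DA(3) DB(4) bridge_num_edges[OF bridge] by simp
  ultimately show ?thesis
    using DA(1) DB(1) unfolding isolable_def by (intro exI[of _ "DB \<union> DA"]) auto
qed

lemma tree_on_bridge:
  assumes "A \<union> B \<subseteq> V" "bridge A B x y" "tree_on A" "tree_on B"
  shows "tree_on (A \<union> B)"
proof -
  have "connected_on (A \<union> B)"
    using assms connected_on_Un[OF _ _ bridge_edge[OF assms(2)]]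
    by (auto simp: tree_on_def bridge_def)
  moreover have "card (A \<union> B) = card A + card B"
    using assms(1,2) finite_vertex_set by (intro card_Un_disjoint) (auto simp: bridge_def)
  ultimately show ?thesis using assms(3,4) bridge_num_edges[OF assms(2)] by (simp add: tree_on_def)
qed

lemma pure_special_bridge:
  assumes V: "A \<union> A' \<subseteq> V" and bridge: "bridge A A' x y"
    and pure: "pure_special A T B" "x \<in> T" and pure': "pure_special A' T' B'" "y \<in> T'"
  shows "pure_special (A \<union> A') (T \<union> T') (\<lambda>t. if t \<in> T then B t else B' t)"
proof -
  let ?B = "\<lambda>t. if t \<in> T then B t else B' t"
  have subset: "T \<subseteq> A" "T' \<subseteq> A'" using hubs_subset[OF pure(1)] hubs_subset[OF pure'(1)] .
  have disjoint: "A \<inter> A' = {}" using bridge by (simp add: bridge_def)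
  then have T_T': "t \<notin> T" if "t \<in> T'" for t using that subset by blast
  have UN: "(\<Union>t\<in>T \<union> T'. f (?B t)) = (\<Union>t\<in>T. f (B t)) \<union> (\<Union>t\<in>T'. f (B' t))"
    for f :: "'a set \<Rightarrow> 'b set"
    using T_T' by (auto split: if_splits)
  have hubs: "bridge T T' x y" using bridge_subset[OF bridge subset pure(2) pure'(2)] .
  have "tree_on (T \<union> T')"
    using V subset pure_special_tree[OF pure(1)] pure_special_tree[OF pure'(1)]
    by (intro tree_on_bridge[OF _ hubs]) auto
  moreover have "A \<union> A' = (\<Union>t\<in>T \<union> T'. ?B t)"
    using UN[of "\<lambda>X. X"] pure_special_cover[OF pure(1)] pure_special_cover[OF pure'(1)] by simp
  moreover have "disjoint_family_on ?B (T \<union> T')"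
    unfolding disjoint_family_on_def
  proof (intro ballI impI)
    fix s t assume st: "s \<in> T \<union> T'" "t \<in> T \<union> T'" "s \<noteq> t"
    have mixed: "B p \<inter> B' q = {}" if "p \<in> T" "q \<in> T'" for p q
      using constituent_subset[OF pure(1) that(1)] constituent_subset[OF pure'(1) that(2)] disjoint
      by blast
    have "B s \<inter> B t = {}" if "s \<in> T" "t \<in> T"
      using disjoint_family_onD[OF pure_special_disjoint[OF pure(1)] that st(3)] .
    moreover have "B' s \<inter> B' t = {}" if "s \<in> T'" "t \<in> T'"
      using disjoint_family_onD[OF pure_special_disjoint[OF pure'(1)] that st(3)] .
    ultimately show "?B s \<inter> ?B t = {}"
      using st(1,2) mixed[of s t] mixed[of t s] T_T' by (auto simp: Int_commute)
  qed
  moreover have "pendant_square t (?B t)" if "t \<in> T \<union> T'" for t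
    using that pure_special_pendant[OF pure(1)] pure_special_pendant[OF pure'(1)] by auto
  moreover have "edges_in (A \<union> A') \<subseteq> edges_in (T \<union> T') \<union> (\<Union>t\<in>T \<union> T'. edges_in (?B t))"
    using pure_special_edges[OF pure(1)] pure_special_edges[OF pure'(1)] bridge hubs
    unfolding UN edges_in_Un bridge_def by auto
  ultimately show ?thesis by (simp add: pure_special_def)
qed

lemma bridge_extremal:
  assumes "A \<union> B \<subseteq> V" "bridge A B x y" "extremal A" "extremal B"
  shows "slack (A \<union> B) \<or> extremal (A \<union> B)"
proof -
  consider (hubs) "hub A x" "hub B y" | (left) "\<not> hub A x" | (right) "\<not> hub B y" by blast
  then show ?thesis
  proof cases
    case hubs
    then obtain T B' T' B'' where "pure_special A T B'" "x \<in> T" "pure_special B T' B''" "y \<in> T'"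
      by (auto simp: hub_def)
    from pure_special_bridge[OF assms(1,2) this] show ?thesis by (auto simp: extremal_def)
  next
    case left
    then show ?thesis using bridge_non_hub_slack assms by blast
  next
    case right
    then show ?thesis
      using bridge_non_hub_slack[OF _ bridge_commute[OF assms(2)]] assms by (simp add: Un_commute)
  qed
qed

lemma bridge_slack:
  assumes "B \<subseteq> V" "bridge A B x y" "slack A" "slack B \<or> extremal B"
  shows "slack (A \<union> B)"
  using bridge_isolable[OF assms(2,3) slack_or_extremal_isolable[OF assms(1,4)]]
    bridge_num_edges[OF assms(2)] by simp

lemma bridge_slack_or_extremal:
  assumes "A \<union> B \<subseteq> V" "bridge A B x y" "slack A \<or> extremal A" "slack B \<or> extremal B"
  shows "slack (A \<union> B) \<or> extremal (A \<union> B)"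
proof -
  consider (left) "slack A" | (right) "slack B" | (extremal) "extremal A" "extremal B"
    using assms(3,4) by blast
  then show ?thesis
  proof cases
    case left
    then show ?thesis using bridge_slack[OF _ assms(2)] assms(1,4) by simp
  next
    case right
    then show ?thesis
      using bridge_slack[OF _ bridge_commute[OF assms(2)]] assms(1,3) by (simp add: Un_commute)
  next
    case extremal
    then show ?thesis by (rule bridge_extremal[OF assms(1,2)])
  qed
qed

lemma square_bridge_pure_special:
  assumes "square A" "bridge A {y} x y"
  shows "pure_special (A \<union> {y}) {y} (\<lambda>_. A \<union> {y})"
proof -
  have "A \<union> {y} - {y} = A" using assms(2) by (auto simp: bridge_def)
  then have "pendant_square y (A \<union> {y})"
    using assms crossing_commute[of A "{y}"] by (simp add: pendant_square_def bridge_def)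
  then show ?thesis by (simp add: pure_special_def tree_on_singleton disjoint_family_on_def)
qed

definition bridgeless :: "'a set \<Rightarrow> bool" where
  "bridgeless S \<longleftrightarrow> (\<forall>A\<subseteq>S. A \<noteq> {} \<longrightarrow> A \<noteq> S \<longrightarrow> 2 \<le> card (crossing A (S - A)))"

lemma bridgelessD:
  "bridgeless S \<Longrightarrow> A \<subseteq> S \<Longrightarrow> A \<noteq> {} \<Longrightarrow> A \<noteq> S \<Longrightarrow> 2 \<le> card (crossing A (S - A))"
  by (simp add: bridgeless_def)

context
  fixes S
  assumes S_V: "S \<subseteq> V" and conn: "connected_on S"
    and IH: "\<And>R. R \<subset> S \<Longrightarrow> connected_on R \<Longrightarrow> classified R"
begin

lemma bridge_non_squares:
  assumes "A \<union> B = S" "bridge A B x y" "\<not> square A" "\<not> square B"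
  shows "slack S \<or> extremal S"
proof -
  have "connected_on A" "connected_on B"
    using bridge_connected_on[OF assms(2)] bridge_connected_on[OF bridge_commute[OF assms(2)]]
      conn assms(1) by (auto simp: Un_commute)
  moreover have "A \<subset> S" "B \<subset> S" using assms(1,2) by (auto simp: bridge_def)
  ultimately have "classified A" "classified B" using IH by auto
  then show ?thesis
    using bridge_slack_or_extremal[OF _ assms(2)] S_V assms by (auto simp: classified_def)
qed

text \<open>The vertex \<open>y\<close> isolates every square to which it is linked, and in particular saves the
  five edges of \<open>A\<close> and its link.\<close>

lemma square_component_slack:
  assumes P: "components (S - {y}) P" and "y \<in> S"
    and A: "A \<in> P" "square A" "P \<noteq> {A}"
    and links: "\<And>H. H \<in> P \<Longrightarrow> square H \<or> 2 \<le> card (crossing H {y})"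
  shows "slack S"
proof (rule slack_by_parts[OF P])
  define g where "g H = (if H = A then 5 else 1 :: nat)" for H
  show "{y} \<subseteq> S" "{y} \<subseteq> {y}" using \<open>y \<in> S\<close> by auto
  show "isolates {y} {y}" by (intro isolates_if_few_left[of _ _ "{}"]) (auto simp: mem_N_iff)
  have "sum g P = 5 + card (P - {A})"
    using finite_components[OF P] A(1) by (simp add: sum.remove g_def)
  moreover have "P - {A} \<noteq> {}" using A by blast
  then have "card (P - {A}) > 0" using finite_components[OF P] by (simp add: card_gt_0_iff)
  ultimately show "6 * card {y} \<le> num_edges {y} + sum g P" by simp
  fix H assume H: "H \<in> P"
  have linked: "crossing H {y} \<noteq> {}" using component_linked[OF P conn refl _ _ H] \<open>y \<in> S\<close> by simp
  have no_survivor: "surviving ({y} \<union> D) H {y} = {}" for D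
    by (intro surviving_empty) (simp add: mem_N_iff)
  show "\<exists>D\<subseteq>H. isolates H ({y} \<union> D) \<and> card (surviving ({y} \<union> D) H {y}) \<le> 1 \<and>
      6 * card D + g H \<le> num_edges H + card (crossing H {y})"
  proof (cases "square H")
    case True
    have "card (crossing H {y}) > 0" using linked by (simp add: card_gt_0_iff)
    then have "g H \<le> num_edges H + card (crossing H {y})"
      using square_num_edges[OF True] by (auto simp: g_def)
    then show ?thesis
      using linked_square_isolates[OF True linked] no_survivor[of "{}"]
      by (intro exI[of _ "{}"]) simp
  next
    case False
    have "H \<subset> S" using component_subset[OF P H] \<open>y \<in> S\<close> by auto
    then have "slack H \<or> extremal H" "H \<subseteq> V"
      using IH[OF _ component_connected_on[OF P H]] False S_V by (auto simp: classified_def)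
    then have "isolable H (num_edges H + 1)" using slack_or_extremal_isolable by blast
    then obtain D where D: "D \<subseteq> H" "isolates H D" "6 * card D \<le> num_edges H + 1"
      by (auto simp: isolable_def)
    moreover have "g H = 1" using False A(2) by (auto simp: g_def)
    moreover have "isolates H ({y} \<union> D)" by (rule isolates_mono[OF D(2)]) auto
    ultimately show ?thesis using no_survivor links[OF H] False by (intro exI[of _ D]) simp
  qed
qed

lemma single_link_component:
  assumes P: "components (S - {y}) P" and "y \<in> S" and A: "A \<in> P" "square A"
    and H: "H \<in> P" "\<not> square H" "card (crossing H {y}) = 1"
  shows "slack S \<or> extremal S"
proof -
  have "card (crossing H (S - H)) = 1"
    using component_crossing[OF P H(1) refl] H(3) \<open>y \<in> S\<close> by simp
  then obtain z z' where bridge: "bridge H (S - H) z z'" using bridgeE[of H "S - H"] by auto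
  have "H \<inter> A = {}"
    using disjoint_family_onD[OF components_disjoint[OF P] H(1) A(1)] H(2) A(2) by blast
  then have "insert y A \<subseteq> S - H" using component_subset[OF P] H(1) A(1) \<open>y \<in> S\<close> by blast
  then have "card (insert y A) \<le> card (S - H)"
    using finite_vertex_set[OF S_V] by (intro card_mono) auto
  moreover have "y \<notin> A" using component_subset[OF P A(1)] by blast
  then have "card (insert y A) = 5"
    using square_card[OF A(2)] card_ge_0_finite[of A] by simp
  ultimately have "\<not> square (S - H)" using square_card[of "S - H"] by auto
  moreover have "H \<union> (S - H) = S" using component_subset[OF P H(1)] by auto
  ultimately show ?thesis using bridge_non_squares[OF _ bridge H(2)] by simp
qed

lemma bridge_square:
  assumes AB: "A \<union> B = S" and bridge: "bridge A B x y" and "square A"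
  shows "slack S \<or> extremal S"
proof -
  have "y \<in> S" "y \<in> B" using bridge AB by (auto simp: bridge_def)
  obtain Q where Q: "components (B - {y}) Q"
    using components_exist[of "B - {y}"] finite_vertex_set[OF S_V] AB by auto
  have P: "components (S - {y}) (insert A Q)"
    using bridge_components[OF bridge _ Q] conn AB by simp
  consider (none) "Q = {}" | (one_link) H where "H \<in> Q" "\<not> square H" "card (crossing H {y}) = 1"
    | (gain) "Q \<noteq> {}" "\<forall>H\<in>Q. square H \<or> 2 \<le> card (crossing H {y})"
  proof -
    have "card (crossing H {y}) > 0" if "H \<in> Q" for H
      using component_linked[OF P conn refl, of H] that \<open>y \<in> S\<close> by (simp add: card_gt_0_iff)
    then show ?thesis using that by (metis One_nat_def Suc_lessI less_eq_Suc_le numeral_2_eq_2)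
  qed
  then show ?thesis
  proof cases
    case none
    then have "B = {y}" using components_Union[OF Q] \<open>y \<in> B\<close> by auto
    then have "pure_special S {y} (\<lambda>_. A \<union> {y})"
      using square_bridge_pure_special[OF \<open>square A\<close>, of y x] bridge AB by simp
    then show ?thesis unfolding extremal_def by blast
  next
    case one_link
    then show ?thesis using single_link_component[OF P \<open>y \<in> S\<close> _ \<open>square A\<close>] by blast
  next
    case gain
    have "A \<notin> Q" using component_subset[OF Q] bridge by (auto simp: bridge_def)
    then have "insert A Q \<noteq> {A}" using gain(1) by blast
    then show ?thesis
      using square_component_slack[OF P \<open>y \<in> S\<close>, of A] gain(2) \<open>square A\<close> by blast
  qed
qed

lemma not_bridgeless:
  assumes "\<not> bridgeless S" shows "slack S \<or> extremal S"
proof -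
  obtain A where A: "A \<subseteq> S" "A \<noteq> {}" "A \<noteq> S" "card (crossing A (S - A)) < 2"
    using assms by (auto simp: bridgeless_def not_le)
  moreover have "crossing A (S - A) \<noteq> {}" using conn A(1-3) unfolding connected_on_def by blast
  then have "card (crossing A (S - A)) > 0" by (simp add: card_gt_0_iff)
  ultimately have "card (crossing A (S - A)) = 1" by simp
  then obtain x y where bridge: "bridge A (S - A) x y" using bridgeE[of A "S - A"] by auto
  have Un: "A \<union> (S - A) = S" "(S - A) \<union> A = S" using A(1) by auto
  consider (left) "square A" | (right) "square (S - A)" | (neither) "\<not> square A" "\<not> square (S - A)"
    by blast
  then show ?thesis
  proof cases
    case left
    then show ?thesis using bridge_square[OF Un(1) bridge] by simp
  next
    case right
    then show ?thesis using bridge_square[OF Un(2) bridge_commute[OF bridge]] by simp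
  next
    case neither
    then show ?thesis using bridge_non_squares[OF Un(1) bridge] by simp
  qed
qed

end

section \<open>Bridgeless graphs\<close>

lemma bridgeless_Diff_connected_on:
  assumes "bridgeless S" "Q \<subseteq> S" "Q \<noteq> {}" "Q \<noteq> S" "card (crossing Q (S - Q)) \<le> 3"
  shows "connected_on (S - Q)"
  unfolding connected_on_def
proof (intro conjI allI impI notI)
  show False if "S - Q = {}" using that assms(2,4) by blast
  fix Z assume Z: "Z \<subseteq> S - Q" "Z \<noteq> {}" "Z \<noteq> S - Q" and no_edge: "crossing Z (S - Q - Z) = {}"
  define Z' where "Z' = S - Q - Z"
  have links: "2 \<le> card (crossing Y Q)"
    if Y: "Y \<subseteq> S - Q" "Y \<noteq> {}" "crossing Y (S - Q - Y) = {}" for Y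
  proof -
    have "S - Y = Q \<union> (S - Q - Y)" using Y(1) assms(2) by auto
    then have "crossing Y (S - Y) = crossing Y Q" using Y(3) crossing_Un by simp
    moreover have "Y \<subseteq> S" "Y \<noteq> S" using Y(1) assms(2,3) by auto
    ultimately show ?thesis using bridgelessD[OF assms(1), of Y] Y(2) by simp
  qed
  have Z': "Z' \<subseteq> S - Q" "Z' \<noteq> {}" "S - Q - Z' = Z" "Z \<union> Z' = S - Q" using Z by (auto simp: Z'_def)
  have "2 \<le> card (crossing Z Q)" using links Z no_edge by simp
  moreover have "2 \<le> card (crossing Z' Q)"
    using links[OF Z'(1,2)] no_edge crossing_commute[of Z' Z] Z'(3) by (simp add: Z'_def)
  moreover have "card (crossing Z Q \<union> crossing Z' Q) = card (crossing Z Q) + card (crossing Z' Q)"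
    using Z(1) Z'(1) by (intro card_Un_disjoint crossing_disjoint) (auto simp: Z'_def)
  moreover have "crossing Z Q \<union> crossing Z' Q = crossing Q (S - Q)"
    using crossing_Un[of Q Z Z'] Z'(4) crossing_commute[of Q] by simp
  ultimately show False using assms(5) by simp
qed

lemma classified_dominating:
  assumes "R \<subseteq> V" "classified R" "x \<in> R" "{h, x} \<in> E"
  obtains D where "D \<subseteq> insert h R" "h \<in> N D" "isolates R D" "6 * card D \<le> num_edges R + 6"
proof -
  have h_N: "h \<in> N D" if "x \<in> D \<or> h \<in> D" for D
    using that assms(4) by (auto simp: mem_N_iff insert_commute)
  consider (square) "square R" | (slack) "slack R" | (extremal) "extremal R"
    using assms(2) by (auto simp: classified_def)
  then show ?thesis
  proof cases
    case square
    have "isolates R {x}" using square assms(3) by (intro square_isolates) (auto simp: mem_N_iff)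
    then show ?thesis using that[of "{x}"] assms(3) h_N by auto
  next
    case slack
    then obtain D where D: "D \<subseteq> R" "isolates R D" "6 * card D \<le> num_edges R"
      by (auto simp: isolable_def)
    have "isolates R (insert h D)" using isolates_mono[OF D(2) order_refl] by blast
    moreover have "card (insert h D) \<le> card D + 1"
      by (cases "finite D") (auto simp: card_insert_if)
    ultimately show ?thesis using that[of "insert h D"] h_N[of "insert h D"] D by auto
  next
    case extremal
    obtain D where "D \<subseteq> R" "x \<in> D" "isolates R D" "6 * card D = num_edges R + 1"
      using extremal_through[OF assms(1) extremal assms(3)] by metis
    then show ?thesis using that[of D] h_N by auto
  qed
qed

lemma square_two_links_slack:
  assumes S: "S \<subseteq> V" "bridgeless S" and IH: "\<And>R. R \<subset> S \<Longrightarrow> connected_on R \<Longrightarrow> classified R"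
    and Q: "square Q" "Q \<subseteq> S" "card (crossing Q (S - Q)) = 2"
  shows "slack S"
proof -
  have "crossing Q (S - Q) \<noteq> {}" using Q(3) by force
  then obtain h x where link: "h \<in> Q" "x \<in> S - Q" "{h, x} \<in> E" by (metis crossingE ex_in_conv)
  have "connected_on (S - Q)"
    using bridgeless_Diff_connected_on[OF S(2) Q(2)] Q(3) link by auto
  then have "classified (S - Q)" using IH link Q(2) by blast
  then obtain D where D: "D \<subseteq> insert h (S - Q)" "h \<in> N D" "isolates (S - Q) D"
    "6 * card D \<le> num_edges (S - Q) + 6"
    using classified_dominating[of "S - Q" x h] link(2,3) S(1) by (metis Diff_subset order_trans)
  have "isolates S D"
  proof (rule isolates_separated[of "{Q}"])
    show "isolates (S - \<Union>{Q}) D" using D(3) by simp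
    fix H assume "H \<in> {Q}"
    have "surviving D Q (S - Q) \<subseteq> crossing Q (S - Q) - {{h, x}}"
      using D(2) by (auto simp: surviving_def)
    then have "card (surviving D Q (S - Q)) \<le> card (crossing Q (S - Q) - {{h, x}})"
      by (simp add: card_mono)
    also have "\<dots> = 1" using Q(3) crossingI[OF link(3,1,2)] by simp
    finally show "isolates H D \<and> card (surviving D H (S - H)) \<le> 1"
      using \<open>H \<in> {Q}\<close> square_isolates[OF Q(1)] D(2) link(1) by blast
  qed
  moreover have "num_edges S = num_edges (S - Q) + 6"
    using num_edges_Un[of Q "S - Q"] Q(3) square_num_edges[OF Q(1)] Un_absorb1[OF Q(2)] by simp
  moreover have "D \<subseteq> S" using D(1) link(1) Q(2) by auto
  ultimately show ?thesis using D(4) unfolding isolable_def by auto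
qed

lemma max_degree_two_cycle:
  assumes S: "S \<subseteq> V" "connected_on S" and degree: "\<And>z. z \<in> S \<Longrightarrow> card (nbrs S z) \<le> 2"
    and K: "subgraph_of K G" "verts K \<subseteq> S" "graph_iso K (cycle_graph n)" "n \<ge> 3"
  shows "K = induced S"
proof -
  have K_E: "edges K \<subseteq> E" and simple_K: "simple_graph K" using K(1) by (auto simp: subgraph_of_def)
  have nbrs_K: "{y \<in> verts K. {z, y} \<in> edges K} = nbrs S z" if z: "z \<in> verts K" for z
  proof (rule card_seteq)
    show "finite (nbrs S z)" using finite_nbrs[OF S(1)] .
    show "{y \<in> verts K. {z, y} \<in> edges K} \<subseteq> nbrs S z" using K(2) K_E by (auto simp: nbrs_def)
    show "card (nbrs S z) \<le> card {y \<in> verts K. {z, y} \<in> edges K}"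
      using degree[of z] cycle_degree[OF simple_K K(3,4) z] z K(2) by fastforce
  qed
  have "verts K = S"
  proof (rule ccontr)
    assume "verts K \<noteq> S"
    moreover have "verts K \<noteq> {}" using graph_iso_card_verts[OF K(3)] K(4) by auto
    ultimately obtain p q where "p \<in> verts K" "q \<in> S - verts K" "{p, q} \<in> E"
      using connected_onE[OF S(2) K(2)] by metis
    then show False using nbrs_K[of p] by (auto simp: nbrs_def)
  qed
  moreover have "edges K = edges_in S"
  proof
    show "edges K \<subseteq> edges_in S"
      using K_E edges_subset_Pow[OF simple_K] K(2) by (auto simp: edges_in_def)
    show "edges_in S \<subseteq> edges K"
    proof
      fix e assume "e \<in> edges_in S"
      moreover from this obtain a b where "e = {a, b}" unfolding edges_in_def by (blast elim: edgeE)
      ultimately show "e \<in> edges K"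
        using nbrs_K[of a] \<open>verts K = S\<close> by (auto simp: nbrs_def mem_edges_in_iff)
    qed
  qed
  ultimately show ?thesis by (simp add: induced_def)
qed

lemma max_degree_two_classified:
  assumes S: "S \<subseteq> V" "connected_on S" and degree: "\<And>z. z \<in> S \<Longrightarrow> card (nbrs S z) \<le> 2"
  shows "classified S"
proof (cases "\<exists>C. cycle_set 4 C \<and> C \<subseteq> S")
  case False
  then have "isolates S {}" by (auto simp: isolates_def)
  then have "slack S" unfolding isolable_def by (intro exI[of _ "{}"]) simp
  then show ?thesis by (simp add: classified_def)
next
  case True
  have spanning: "C = S \<and> (\<exists>n\<ge>4. graph_iso (induced S) (cycle_graph n))"
    if C: "cycle_set 4 C" "C \<subseteq> S" for C
  proof -
    obtain K n where K: "subgraph_of K G" "verts K = C" "n \<ge> 4" "graph_iso K (cycle_graph n)"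
      using C(1) by (auto elim: cycle_setE)
    then have "K = induced S" using max_degree_two_cycle[OF S degree, of K n] C(2) by simp
    then show ?thesis using K by auto
  qed
  then obtain n where n: "n \<ge> 4" "graph_iso (induced S) (cycle_graph n)" using True by blast
  consider (square) "n = 4" | (pentagon) "n = 5" | (long) "n \<ge> 6" using n(1) by linarith
  then show ?thesis
  proof cases
    case long
    obtain z where "z \<in> S" using S(2) connected_on_nonempty by blast
    moreover have "z \<in> N {z}" by (simp add: mem_N_iff)
    ultimately have "isolates S {z}" using spanning unfolding isolates_def by blast
    moreover have "num_edges S = n"
      using induced_iso_num_edges[OF n(2)] n(1)
      by (simp add: simple_cycle_graph card_edges_cycle_graph)
    ultimately have "slack S"
      using long \<open>z \<in> S\<close> unfolding isolable_def by (intro exI[of _ "{z}"]) simp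
    then show ?thesis by (simp add: classified_def)
  qed (use n(2) in \<open>auto simp: classified_def extremal_def\<close>)
qed

section \<open>Vertices of degree at least three\<close>

text \<open>Such a part \<open>H\<close> needs no help from \<open>X\<close>: it pays for its own isolation, and no cycle that
  remains passes between \<open>H\<close> and \<open>X\<close>.\<close>

definition detachable :: "'a set \<Rightarrow> 'a set \<Rightarrow> bool" where
  "detachable H X \<longleftrightarrow> (\<exists>D\<subseteq>H. isolates H D \<and> card (surviving D H X) \<le> 1 \<and>
     6 * card D \<le> num_edges H + card (crossing H X))"

lemma detachable_parts_slack:
  assumes "components (S - X) P" "X \<subseteq> S" "isolates X {}" "\<And>H. H \<in> P \<Longrightarrow> detachable H X"
  shows "slack S"
  by (rule slack_by_parts[OF assms(1,2), of "{}" "\<lambda>_. 0"])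
    (use assms(3,4) in \<open>auto simp: detachable_def\<close>)

lemma surviving_subset_crossing:
  assumes "H \<subseteq> N D \<union> L" shows "surviving D H X \<subseteq> crossing L X"
proof
  fix e assume e: "e \<in> surviving D H X"
  then obtain x y where xy: "e = {x, y}" "x \<in> H" "y \<in> X" "{x, y} \<in> E"
    by (auto simp: surviving_def elim: crossingE)
  then have "x \<in> L" using e assms by (auto simp: surviving_def)
  then show "e \<in> crossing L X" using xy crossingI by auto
qed

lemma card_surviving_le:
  assumes "H \<subseteq> N D \<union> L" "card (crossing L X) \<le> 1"
  shows "card (surviving D H X) \<le> 1"
  using card_mono[OF finite_crossing surviving_subset_crossing[OF assms(1)]] assms(2) order_trans
  by blast

lemma detachable_by_vertex:
  assumes "z \<in> H" "H \<subseteq> N {z} \<union> L" "finite L" "card L < 4" "card (crossing L X) \<le> 1"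
    and "6 \<le> num_edges H + card (crossing H X)"
  shows "detachable H X"
  unfolding detachable_def
  using assms isolates_if_few_left[OF assms(2-4)] card_surviving_le[OF assms(2,5)]
  by (intro exI[of _ "{z}"]) simp

context
  fixes S X H
  assumes S_V: "S \<subseteq> V" and X_S: "X \<subseteq> S" and H_S: "H \<subseteq> S - X"
    and max_degree: "\<And>z. z \<in> S \<Longrightarrow> card (nbrs S z) \<le> 3"
begin

lemma cycle_vertex_links:
  assumes "cycle_set k C" "3 \<le> k" "C \<subseteq> H" "h \<in> C"
  shows "card (crossing {h} X) \<le> 1"
proof -
  have "C \<subseteq> V" "X \<subseteq> V" "C \<inter> X = {}" using assms(3) H_S X_S S_V by auto
  then have "card (nbrs C h) + card (nbrs X h) = card (nbrs C h \<union> nbrs X h)"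
    by (intro card_Un_disjoint[symmetric] finite_nbrs) (auto simp: nbrs_def)
  also have "\<dots> \<le> card (nbrs S h)"
    using assms(3) H_S X_S finite_nbrs[OF S_V] by (intro card_mono) (auto simp: nbrs_def)
  also have "\<dots> \<le> 3" using max_degree assms(3,4) H_S by auto
  finally show ?thesis using card_nbrs_cycle[OF assms(1,2,4)] by (simp add: card_crossing_singleton)
qed

lemma square_oppositeE:
  assumes "square Q" "Q \<subseteq> H" "z \<in> Q"
  obtains b where "Q \<subseteq> N {z} \<union> {b}" "card (crossing {b} X) \<le> 1"
proof -
  obtain a b c where Q: "Q = {z, a, b, c}"
    and edges: "edges_in Q = {{z, a}, {a, b}, {b, c}, {c, z}}"
    using assms(1,3) by (rule square_vertexE)
  have "{z, a} \<in> edges_in Q" "{z, c} \<in> edges_in Q" unfolding edges by auto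
  then have "Q \<subseteq> N {z} \<union> {b}" unfolding Q by (auto simp: mem_N_iff mem_edges_in_iff)
  moreover have "cycle_set 4 Q"
    using assms(1,2) H_S S_V by (intro induced_cycle_cycle_set[of _ 4]) auto
  then have "card (crossing {b} X) \<le> 1" using cycle_vertex_links assms(2) Q by simp
  ultimately show ?thesis using that by blast
qed

lemma square_detachable:
  assumes "square H" "2 \<le> card (crossing H X)" shows "detachable H X"
proof -
  obtain z where "z \<in> H" using square_card[OF assms(1)] by fastforce
  moreover from this obtain b where "H \<subseteq> N {z} \<union> {b}" "card (crossing {b} X) \<le> 1"
    using square_oppositeE[OF assms(1)] by blast
  ultimately show ?thesis
    using assms square_num_edges[of H] by (intro detachable_by_vertex[of z H "{b}"]) auto
qed

lemma extremal_through_link: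
  assumes "extremal H" "card (crossing H X) = 2" "u \<in> H" "x \<in> X" "{u, x} \<in> E"
  obtains D where "D \<subseteq> H" "u \<in> D" "isolates H D" "card (surviving D H X) \<le> 1"
    "6 * card D = num_edges H + 1"
proof -
  obtain D where D: "D \<subseteq> H" "u \<in> D" "isolates H D" "6 * card D = num_edges H + 1"
    using extremal_through[OF _ assms(1,3)] H_S S_V by blast
  have "surviving D H X \<subseteq> crossing H X - {{u, x}}"
    using D(2) by (auto simp: surviving_def mem_N_iff)
  then have "card (surviving D H X) \<le> card (crossing H X - {{u, x}})" by (simp add: card_mono)
  then have "card (surviving D H X) \<le> 1" using assms(2) crossingI[OF assms(5,3,4)] by simp
  then show ?thesis using that D by blast
qed

lemma diamond_detachable:
  assumes "diamond H" "crossing H X \<noteq> {}" shows "detachable H X"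
proof -
  obtain z where "z \<in> H" "H \<subseteq> N {z}" using assms(1) by (rule diamond_dominating_vertex)
  moreover have "card (crossing H X) > 0" using assms(2) by (simp add: card_gt_0_iff)
  ultimately show ?thesis
    using diamond_num_edges[OF assms(1)] by (intro detachable_by_vertex[of z H "{}"]) auto
qed

lemma pentagon_detachable:
  assumes "pentagon H" "crossing H X \<noteq> {}" "card (crossing H X) \<le> 3" shows "detachable H X"
proof -
  have H_X: "H \<inter> X = {}" using H_S by auto
  have "\<not> H \<subseteq> (\<Union>e\<in>crossing H X. e \<inter> H)"
  proof
    assume "H \<subseteq> (\<Union>e\<in>crossing H X. e \<inter> H)"
    moreover have "finite H" using pentagon_card[OF assms(1)] by (intro card_ge_0_finite) simp
    then have "finite (\<Union>e\<in>crossing H X. e \<inter> H)" by simp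
    ultimately have "card H \<le> card (\<Union>e\<in>crossing H X. e \<inter> H)" by (rule card_mono[rotated])
    then show False using card_UN_crossing_le[OF H_X] pentagon_card[OF assms(1)] assms(3) by simp
  qed
  then obtain p where "p \<in> H" "\<forall>e\<in>crossing H X. p \<notin> e" by blast
  then have p: "p \<in> H" "crossing {p} X = {}" by (auto simp: crossing_def)
  obtain a b c d where H: "H = {p, a, b, c, d}"
    and edges: "edges_in H = {{p, a}, {a, b}, {b, c}, {c, d}, {d, p}}"
    using assms(1) p(1) by (rule pentagon_vertexE)
  have "{a, b} \<in> edges_in H" "{b, c} \<in> edges_in H" unfolding edges by auto
  then have "H \<subseteq> N {b} \<union> {p, d}"
    unfolding H by (auto simp: mem_N_iff mem_edges_in_iff insert_commute)
  moreover have "cycle_set 5 H"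
    using assms(1) H_S S_V by (intro induced_cycle_cycle_set[of _ 5]) auto
  then have "card (crossing {d} X) \<le> 1" using cycle_vertex_links[of 5 H d] H by simp
  then have "card (crossing {p, d} X) \<le> 1"
    using p(2) crossing_Un[of X "{d}" "{p}"] by (simp add: crossing_commute[of _ X])
  moreover have "card (crossing H X) > 0" using assms(2) by (simp add: card_gt_0_iff)
  then have "6 \<le> num_edges H + card (crossing H X)" using pentagon_num_edges[OF assms(1)] by simp
  ultimately show ?thesis
    using H by (intro detachable_by_vertex[of b H "{p, d}"]) (auto simp: card_insert_if)
qed

context
  assumes links: "\<And>x y. x \<in> H \<Longrightarrow> y \<in> S - H \<Longrightarrow> {x, y} \<in> E \<Longrightarrow> y \<in> X"
    and square_links: "\<And>Q. Q \<subseteq> H \<Longrightarrow> square Q \<Longrightarrow> 3 \<le> card (crossing Q (S - Q))"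
begin

lemma constituent_links:
  assumes pure: "pure_special H T B" and t: "t \<in> T"
  shows "2 \<le> card (crossing (B t - {t}) X)"
proof -
  let ?Q = "B t - {t}"
  have Q: "?Q \<subseteq> H" "square ?Q"
    using pure_special_pendant[OF pure t] constituent_subset[OF pure t]
    by (auto simp: pendant_square_def)
  have H_V: "H \<subseteq> V" using H_S S_V by auto
  have "crossing ?Q (S - ?Q) \<subseteq> crossing ?Q (H - ?Q) \<union> crossing ?Q X"
    using links Q(1) by (fastforce simp: crossing_def)
  also have "crossing ?Q (H - ?Q) = crossing {t} ?Q"
    using constituent_square_crossing[OF H_V pure t] crossing_commute by simp
  finally have "card (crossing ?Q (S - ?Q)) \<le> card (crossing {t} ?Q \<union> crossing ?Q X)"
    by (simp add: card_mono)
  also have "\<dots> \<le> card (crossing {t} ?Q) + card (crossing ?Q X)" by (rule card_Un_le)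
  finally show ?thesis
    using square_links[OF Q] pure_special_pendant[OF pure t] by (simp add: pendant_square_def)
qed

lemma pure_special_detachable:
  assumes pure: "pure_special H T B" and "crossing H X \<noteq> {}" "card (crossing H X) \<le> 3"
  shows "detachable H X"
proof -
  have H_V: "H \<subseteq> V" and H_X: "H \<inter> X = {}" using H_S S_V by auto
  have "2 * card T = (\<Sum>t\<in>T. 2)" by simp
  also have "\<dots> \<le> (\<Sum>t\<in>T. card (crossing (B t - {t}) X))"
    using constituent_links[OF pure] by (rule sum_mono)
  also have "\<dots> = card (crossing (\<Union>t\<in>T. B t - {t}) X)"
    using finite_hubs[OF H_V pure] pure_special_cover[OF pure] pure_special_disjoint[OF pure] H_X
    by (intro card_crossing_UN[symmetric]) (auto simp: disjoint_family_on_def)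
  also have "\<dots> \<le> card (crossing H X)"
    using pure_special_cover[OF pure] by (intro card_mono crossing_mono) auto
  finally have "card T \<le> 1" using assms(3) by simp
  moreover have "card T > 0"
    using pure_special_tree[OF pure] unfolding tree_on_def by linarith
  ultimately have "card T = 1" by simp
  then obtain t where T: "T = {t}" by (rule card_1_singletonE)
  have pendant: "t \<in> B t" "pendant_square t (B t)" and H: "H = B t"
    using pure_special_cover[OF pure] pure_special_pendant[OF pure] T
    by (auto simp: pendant_square_def)
  obtain w where w: "w \<in> B t - {t}" "{t, w} \<in> E"
    using pendant(2) by (rule pendant_square_attachmentE)
  obtain b where b: "B t - {t} \<subseteq> N {w} \<union> {b}" "card (crossing {b} X) \<le> 1"
    using square_oppositeE[of "B t - {t}" w] pendant(2) H w(1) by (auto simp: pendant_square_def)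
  have "t \<in> N {w}" using w(2) by (auto simp: mem_N_iff insert_commute)
  then have "H \<subseteq> N {w} \<union> {b}" using b(1) H by blast
  moreover have "card (crossing H X) > 0" using assms(2) by (simp add: card_gt_0_iff)
  then have "6 \<le> num_edges H + card (crossing H X)"
    using pendant_square_num_edges[OF pendant(2)] H by simp
  ultimately show ?thesis using b(2) w(1) H by (intro detachable_by_vertex[of w H "{b}"]) auto
qed

lemma extremal_detachable:
  assumes "extremal H" "card (crossing H X) \<in> {2, 3}" shows "detachable H X"
proof -
  have "crossing H X \<noteq> {}" "card (crossing H X) \<le> 3" using assms(2) by auto
  then show ?thesis
    using assms(1) pure_special_detachable diamond_detachable pentagon_detachable
    unfolding extremal_def by blast
qed

end

end

lemma card_le_edges_at:
  assumes "finite A" "A \<inter> Y = {}" "\<And>a. a \<in> A \<Longrightarrow> \<exists>z\<in>A \<union> Y. {a, z} \<in> E"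
  shows "card A \<le> 2 * num_edges A + card (crossing A Y)"
proof -
  have "A \<subseteq> \<Union>(edges_in A) \<union> (\<Union>e\<in>crossing A Y. e \<inter> A)"
  proof
    fix a assume "a \<in> A"
    then obtain z where "z \<in> A \<union> Y" "{a, z} \<in> E" using assms(3) by blast
    then have "{a, z} \<in> edges_in A \<or> {a, z} \<in> crossing A Y"
      using \<open>a \<in> A\<close> crossingI by (auto simp: mem_edges_in_iff)
    then show "a \<in> \<Union>(edges_in A) \<union> (\<Union>e\<in>crossing A Y. e \<inter> A)" using \<open>a \<in> A\<close> by blast
  qed
  moreover have "\<Union>(edges_in A) \<union> (\<Union>e\<in>crossing A Y. e \<inter> A) \<subseteq> A" by (auto simp: edges_in_def)
  ultimately have "card A = card (\<Union>(edges_in A) \<union> (\<Union>e\<in>crossing A Y. e \<inter> A))"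
    by (metis subset_antisym)
  also have "\<dots> \<le> card (\<Union>(edges_in A)) + card (\<Union>e\<in>crossing A Y. e \<inter> A)" by (rule card_Un_le)
  also have "card (\<Union>(edges_in A)) \<le> (\<Sum>e\<in>edges_in A. card e)"
    using card_UN_le[of "edges_in A" "\<lambda>e. e"] by simp
  also have "(\<Sum>e\<in>edges_in A. card e) = (\<Sum>e\<in>edges_in A. 2)"
    by (intro sum.cong refl) (simp add: edges_in_def card_edge)
  also have "card (\<Union>e\<in>crossing A Y. e \<inter> A) \<le> card (crossing A Y)"
    by (rule card_UN_crossing_le[OF assms(2)])
  finally show ?thesis by simp
qed

lemma star_acyclic:
  assumes "edges_in A = {}" "cycle_set k C" "3 \<le> k"
  shows "\<not> C \<subseteq> insert v A"
proof
  assume C: "C \<subseteq> insert v A"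
  have "\<not> C \<subseteq> {v}" using no_cycle_in_small_set[of "{v}" k C] assms(2,3) by auto
  then obtain x where x: "x \<in> C" "x \<in> A" using C by auto
  have "nbrs C x \<subseteq> {v}"
  proof
    fix u assume "u \<in> nbrs C x"
    then show "u \<in> {v}" using assms(1) x C mem_edges_in_iff[of x u A] by (auto simp: nbrs_def)
  qed
  then have "card (nbrs C x) \<le> 1" using card_mono[of "{v}"] by simp
  then show False using card_nbrs_cycle[OF assms(2,3) x(1)] by simp
qed

text \<open>The case of a vertex \<open>v\<close> of maximum degree \<open>k \<ge> 3\<close>. By \<open>total_gain\<close>, the \<open>k\<close> edges at \<open>v\<close>, the
  edges among its neighbours and the gains of the components add up to less than \<open>6\<close>.\<close>

context
  fixes S v P
  assumes S_V: "S \<subseteq> V" and bridgeless: "bridgeless S" and not_slack: "\<not> slack S"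
    and IH: "\<And>R. R \<subset> S \<Longrightarrow> connected_on R \<Longrightarrow> classified R"
    and v: "v \<in> S" "\<And>z. z \<in> S \<Longrightarrow> card (nbrs S z) \<le> card (nbrs S v)" "3 \<le> card (nbrs S v)"
    and P: "components (S - insert v (nbrs S v)) P"
begin

private abbreviation (input) A :: "'a set" where "A \<equiv> nbrs S v"
private abbreviation (input) X :: "'a set" where "X \<equiv> insert v A"
private abbreviation (input) links :: "'a set \<Rightarrow> nat" where "links H \<equiv> card (crossing H X)"
private abbreviation (input) gain :: "'a set \<Rightarrow> nat" where "gain H \<equiv> links H - excess H"

lemma nbrs_subset: "A \<subseteq> S"
  and centre_notin_nbrs: "v \<notin> A"
  and finite_nbrs_centre: "finite A"
  and star_subset: "X \<subseteq> S"
  and nbrs_adjacent: "a \<in> A \<Longrightarrow> {v, a} \<in> E"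
  using v(1) finite_nbrs[OF S_V] by (auto simp: nbrs_def)

lemma num_edges_star: "num_edges X = card A + num_edges A"
proof -
  have "nbrs A v = A" by (auto simp: nbrs_def)
  then show ?thesis
    using num_edges_Un[of "{v}" A] centre_notin_nbrs card_crossing_singleton[of v A] by simp
qed

lemma
  assumes "H \<in> P"
  shows component_subset_Diff: "H \<subseteq> S - X"
    and component_nonempty: "H \<noteq> {}"
    and component_psubset: "H \<subset> S"
    and component_subset_V: "H \<subseteq> V"
    and component_classified: "classified H"
    and component_boundary: "crossing H (S - H) = crossing H X"
proof -
  show subset: "H \<subseteq> S - X" by (rule component_subset[OF P assms])
  show "H \<noteq> {}" using component_connected_on[OF P assms] connected_on_nonempty by simp
  show psubset: "H \<subset> S" and "H \<subseteq> V" using subset v(1) S_V by auto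
  show "classified H" using IH[OF psubset component_connected_on[OF P assms]] .
  show "crossing H (S - H) = crossing H X" by (rule component_crossing[OF P assms refl star_subset])
qed

lemma square_links:
  assumes "Q \<subset> S" "square Q" shows "3 \<le> card (crossing Q (S - Q))"
proof -
  have "card (crossing Q (S - Q)) \<noteq> 2"
    using square_two_links_slack[OF S_V bridgeless IH assms(2)] assms(1) not_slack by blast
  moreover have "Q \<noteq> {}" using square_card[OF assms(2)] by auto
  then have "2 \<le> card (crossing Q (S - Q))" using bridgelessD[OF bridgeless] assms(1) by blast
  ultimately show ?thesis by simp
qed

lemma
  assumes "H \<in> P"
  shows component_links: "2 \<le> links H"
    and square_component_links: "square H \<Longrightarrow> 3 \<le> links H"
  using bridgelessD[OF bridgeless, of H] square_links[of H] component_psubset[OF assms]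
    component_nonempty[OF assms] component_boundary[OF assms] by auto

lemma
  assumes "H \<in> P"
  shows gain_pos: "1 \<le> gain H"
    and links_le_gain: "links H \<le> gain H + 2"
    and excess_le_links: "excess H \<le> links H"
  using component_links[OF assms] square_component_links[OF assms] component_classified[OF assms]
  by (auto simp: excess_def classified_def)

lemma total_gain: "card A + num_edges A + (\<Sum>H\<in>P. gain H) \<le> 5"
proof (rule ccontr)
  assume "\<not> ?thesis"
  then have "6 * card {v} \<le> num_edges X + (\<Sum>H\<in>P. gain H)" using num_edges_star by simp
  moreover have X_N: "X \<subseteq> N {v}" using nbrs_adjacent by (auto simp: mem_N_iff)
  have "isolates X {v}" using X_N by (intro isolates_if_few_left[of _ _ "{}"]) auto
  moreover have "\<exists>D\<subseteq>H. isolates H ({v} \<union> D) \<and> card (surviving ({v} \<union> D) H X) \<le> 1 \<and>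
      6 * card D + gain H \<le> num_edges H + links H" if H: "H \<in> P" for H
  proof -
    obtain D where D: "D \<subseteq> H" "isolates H D" "6 * card D \<le> num_edges H + excess H"
      using classified_isolable[OF component_subset_V[OF H] component_classified[OF H]]
      by (auto simp: isolable_def)
    moreover have "isolates H ({v} \<union> D)" by (rule isolates_mono[OF D(2)]) auto
    moreover have "X \<subseteq> N ({v} \<union> D)" using X_N unfolding N_Un by (rule le_supI1)
    then have "surviving ({v} \<union> D) H X = {}" by (rule surviving_empty)
    ultimately show ?thesis using excess_le_links[OF H] by (intro exI[of _ D]) simp
  qed
  ultimately have "slack S" using slack_by_parts[OF P star_subset, of "{v}" gain] by simp
  then show False using not_slack by simp
qed

lemma second_edge:
  assumes "a \<in> A" obtains z where "z \<in> A \<union> (S - X)" "{a, z} \<in> E"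
proof -
  have a: "{a} \<subseteq> S" "{a} \<noteq> S" using assms nbrs_subset centre_notin_nbrs v(1) by auto
  have "\<not> crossing {a} (S - {a}) \<subseteq> {{a, v}}"
  proof
    assume "crossing {a} (S - {a}) \<subseteq> {{a, v}}"
    then have "card (crossing {a} (S - {a})) \<le> card {{a, v}}" by (intro card_mono) auto
    then show False using bridgelessD[OF bridgeless a(1) _ a(2)] by simp
  qed
  then obtain e where "e \<in> crossing {a} (S - {a})" "e \<noteq> {a, v}" by blast
  then obtain z where "z \<in> S" "z \<noteq> v" "{a, z} \<in> E" by (metis DiffD1 crossingE singletonD)
  then show ?thesis using that[of z] by blast
qed

lemma card_nbrs_le_links: "card A \<le> 2 * num_edges A + (\<Sum>H\<in>P. links H)"
proof -
  have "card A \<le> 2 * num_edges A + card (crossing A (S - X))"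
    using second_edge finite_nbrs_centre by (intro card_le_edges_at) blast+
  also have "crossing A (S - X) \<subseteq> crossing (S - X) X"
    unfolding crossing_commute[of A] by (intro crossing_mono) auto
  then have "card (crossing A (S - X)) \<le> card (crossing (S - X) X)" by (simp add: card_mono)
  also have "card (crossing (S - X) X) = (\<Sum>H\<in>P. links H)"
    by (rule card_crossing_components[OF P]) auto
  finally show ?thesis by simp
qed

lemma card_components_le: "card P \<le> (\<Sum>H\<in>P. gain H)"
  using sum_mono[of P "\<lambda>_. 1" gain] gain_pos by simp

lemma degree_three: "card A = 3"
proof -
  have "(\<Sum>H\<in>P. links H) \<le> (\<Sum>H\<in>P. gain H + 2)" using links_le_gain by (rule sum_mono)
  also have "\<dots> = (\<Sum>H\<in>P. gain H) + 2 * card P" by (subst sum.distrib) simp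
  finally have "(\<Sum>H\<in>P. links H) \<le> 3 * (\<Sum>H\<in>P. gain H)" using card_components_le by simp
  then show ?thesis using card_nbrs_le_links total_gain v(3) by simp
qed

lemma num_edges_gain_le: "num_edges A + (\<Sum>H\<in>P. gain H) \<le> 2"
  using total_gain degree_three by simp

lemma single_component:
  assumes "H \<in> P" "(\<Sum>K\<in>P. gain K) \<le> gain H" shows "P = {H}"
proof -
  have "card (P - {H}) \<le> (\<Sum>K\<in>P - {H}. gain K)"
    using sum_mono[of "P - {H}" "\<lambda>_. 1" gain] gain_pos by simp
  also have "\<dots> = 0" using assms sum.remove[OF finite_components[OF P] assms(1), of gain] by simp
  finally have "P - {H} = {}" using finite_components[OF P] by simp
  then show ?thesis using assms(1) by blast
qed

lemma two_chords:
  assumes "num_edges A = 2" shows "diamond S"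
proof -
  have "card P = 0" using card_components_le num_edges_gain_le assms by simp
  then have "S - X = {}" using components_Union[OF P] finite_components[OF P] by simp
  then have S: "S = X" using star_subset by blast
  obtain e f where ef: "edges_in A = {e, f}" "e \<noteq> f" using assms by (auto simp: card_2_iff)
  have "g \<subseteq> A \<and> card g = 2" if "g \<in> edges_in A" for g
    using that by (simp add: edges_in_def card_edge)
  then have "e \<subseteq> A" "f \<subseteq> A" "card e = 2" "card f = 2" using ef(1) by auto
  then obtain a b c where A: "A = {a, b, c}" "distinct [a, b, c]" "e = {a, b}" "f = {b, c}"
    using ef(2) by (rule two_pairs_in_tripleE[OF degree_three])
  then have "diamond {v, a, b, c}"
    using ef(1) centre_notin_nbrs nbrs_adjacent by (intro diamond_fan) auto
  then show ?thesis using S A by simp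
qed

lemma max_degree_three: "u \<in> S \<Longrightarrow> card (nbrs S u) \<le> 3"
  using v(2) degree_three by simp

lemma unit_gain_component_through_link:
  assumes H: "H \<in> P" "gain H = 1" and zx: "z \<in> H" "x \<in> X" "{z, x} \<in> E"
  obtains D where "D \<subseteq> H" "z \<in> D" "isolates H D" "card (surviving D H X) \<le> 1"
    "6 * card D \<le> num_edges H + 2"
proof -
  note H_in_S = S_V star_subset component_subset_Diff[OF H(1)] max_degree_three
  have "\<not> slack H" using H(2) component_links[OF H(1)] by (auto simp: excess_def)
  then consider (extremal) "extremal H" | (square) "square H"
    using component_classified[OF H(1)] by (auto simp: classified_def)
  then show ?thesis
  proof cases
    case extremal
    then have "links H = 2" using H(2) \<open>\<not> slack H\<close> by (simp add: excess_def)
    then obtain D where "D \<subseteq> H" "z \<in> D" "isolates H D" "card (surviving D H X) \<le> 1"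
      "6 * card D = num_edges H + 1"
      using extremal_through_link[OF H_in_S extremal _ zx] by metis
    then show ?thesis using that[of D] by simp
  next
    case square
    obtain b where "H \<subseteq> N {z} \<union> {b}" "card (crossing {b} X) \<le> 1"
      using square_oppositeE[OF H_in_S square order_refl zx(1)] by metis
    then have "card (surviving {z} H X) \<le> 1" by (rule card_surviving_le)
    moreover have "isolates H {z}"
      using square zx(1) by (intro square_isolates) (auto simp: mem_N_iff)
    ultimately show ?thesis using that[of "{z}"] zx(1) square_num_edges[OF square] by simp
  qed
qed

lemma one_chord_slack:
  assumes "num_edges A = 1" shows "slack S"
proof -
  obtain e where e: "edges_in A = {e}" using assms by (rule card_1_singletonE)
  then have "card e = 2" using card_edge by (auto simp: edges_in_def)
  then have "\<not> A \<subseteq> e" using card_mono[of e A] degree_three card_ge_0_finite[of e] by auto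
  then obtain x where x: "x \<in> A" "x \<notin> e" by blast
  obtain z where z: "z \<in> A \<union> (S - X)" "{x, z} \<in> E" using x(1) by (rule second_edge)
  have "z \<notin> A" using e x z(2) mem_edges_in_iff[of x z A] by auto
  then obtain H where H: "H \<in> P" "z \<in> H" using z(1) components_Union[OF P] by blast
  have zx: "{z, x} \<in> E" "x \<in> X" using z(2) x(1) by (simp_all add: insert_commute)
  have "gain H \<le> (\<Sum>K\<in>P. gain K)" using H(1) finite_components[OF P] by (intro member_le_sum) auto
  then have "gain H = 1" "P = {H}"
    using single_component[OF H(1)] num_edges_gain_le assms gain_pos[OF H(1)] by auto
  obtain D where D: "D \<subseteq> H" "z \<in> D" "isolates H D" "card (surviving D H X) \<le> 1"
    "6 * card D \<le> num_edges H + 2"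
    by (rule unit_gain_component_through_link[OF H(1) \<open>gain H = 1\<close> H(2) zx(2,1)])
  have "x \<in> N D" using zx(1) D(2) by (auto simp: mem_N_iff)
  then have "isolates X D"
    using x(1) centre_notin_nbrs finite_nbrs_centre degree_three
    by (intro isolates_if_few_left[of _ _ "X - {x}"]) auto
  then have "isolates S D"
    using isolates_components[OF P star_subset] D(3,4) \<open>P = {H}\<close> by simp
  moreover have "num_edges S = 4 + num_edges H + links H"
    using num_edges_delete[OF P refl star_subset] \<open>P = {H}\<close> num_edges_star assms degree_three
    by simp
  ultimately show ?thesis
    using D(1,5) component_psubset[OF H(1)] unfolding isolable_def by (intro exI[of _ D]) auto
qed

lemma no_chords_slack:
  assumes "num_edges A = 0" shows "slack S"
proof (rule detachable_parts_slack[OF P star_subset])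
  have "edges_in A = {}" using assms by simp
  then show "isolates X {}" using star_acyclic by (auto simp: isolates_def)
  fix H assume H: "H \<in> P"
  have gain_H: "gain H \<le> 2"
    using num_edges_gain_le member_le_sum[OF H _ finite_components[OF P], of gain] by simp
  note H_in_S = S_V star_subset component_subset_Diff[OF H] max_degree_three
  consider (square) "square H" | (slack) "slack H" | (extremal) "extremal H" "\<not> slack H"
    using component_classified[OF H] by (auto simp: classified_def)
  then show "detachable H X"
  proof cases
    case square
    then show ?thesis using square_detachable[OF H_in_S] component_links[OF H] by simp
  next
    case slack
    then have "gain H = links H" by (simp add: excess_def)
    then have "links H = 2" "P = {H}"
      using gain_H component_links[OF H] single_component[OF H] num_edges_gain_le by auto
    then show ?thesis using card_nbrs_le_links assms degree_three by simp
  next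
    case extremal
    show ?thesis
    proof (rule extremal_detachable[OF H_in_S _ _ extremal(1)])
      show "card (crossing H X) \<in> {2, 3}"
        using gain_H extremal component_links[OF H] by (auto simp: excess_def)
      show "3 \<le> card (crossing Q (S - Q))" if "Q \<subseteq> H" "square Q" for Q
        using square_links[of Q] component_psubset[OF H] that by auto
      show "y \<in> X" if "x \<in> H" "y \<in> S - H" "{x, y} \<in> E" for x y
        using component_no_edge[OF P H that(1), of y] that by auto
    qed
  qed
qed

lemma max_degree_ge_three_extremal: "extremal S"
proof -
  have "num_edges A \<noteq> 0" "num_edges A \<noteq> 1" using not_slack no_chords_slack one_chord_slack by blast+
  then have "num_edges A = 2" using num_edges_gain_le by linarith
  then show ?thesis using two_chords by (simp add: extremal_def)
qed

end

theorem connected_on_classified: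
  assumes "S \<subseteq> V" "connected_on S"
  shows "classified S"
  using assms
proof (induction "card S" arbitrary: S rule: less_induct)
  case less
  have finite_S: "finite S" using finite_vertex_set[OF less.prems(1)] .
  have IH: "classified R" if "R \<subset> S" "connected_on R" for R
    using less.hyps[of R] that less.prems(1) psubset_card_mono[OF finite_S that(1)] by auto
  have "Max ((\<lambda>z. card (nbrs S z)) ` S) \<in> (\<lambda>z. card (nbrs S z)) ` S"
    using finite_S connected_on_nonempty[OF less.prems(2)] by (intro Max_in) auto
  then obtain v where "v \<in> S" "card (nbrs S v) = Max ((\<lambda>z. card (nbrs S z)) ` S)" by auto
  then have v: "v \<in> S" "\<And>z. z \<in> S \<Longrightarrow> card (nbrs S z) \<le> card (nbrs S v)" using finite_S by auto
  consider (bridge) "\<not> bridgeless S" | (low_degree) "card (nbrs S v) \<le> 2"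
    | (high_degree) "bridgeless S" "3 \<le> card (nbrs S v)" by linarith
  then show ?case
  proof cases
    case bridge
    then show ?thesis using not_bridgeless[OF less.prems IH] by (auto simp: classified_def)
  next
    case low_degree
    then show ?thesis using max_degree_two_classified[OF less.prems] v(2) by (meson order_trans)
  next
    case high_degree
    obtain P where "components (S - insert v (nbrs S v)) P"
      using components_exist[of "S - insert v (nbrs S v)"] finite_S by blast
    then show ?thesis
      using max_degree_ge_three_extremal[OF less.prems(1) high_degree(1) _ IH v high_degree(2)]
      by (auto simp: classified_def)
  qed
qed

section \<open>The isolation number\<close>

lemma edges_in_V [simp]: "edges_in V = E"
  using edge_subset_V by (auto simp: edges_in_def)

lemma induced_V [simp]: "induced V = G"
  by (simp add: induced_def)

lemma connected_graph_induced_iff: "connected_graph (induced T) \<longleftrightarrow> connected_on T"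
proof
  assume connected: "connected_graph (induced T)"
  have "crossing X (T - X) \<noteq> {}" if X: "X \<subseteq> T" "X \<noteq> {}" "X \<noteq> T" for X
  proof -
    obtain x y where xy: "x \<in> X" "y \<in> T - X" using X by blast
    then have "(x, y) \<in> {(x, y). {x, y} \<in> edges_in T}\<^sup>*"
      using connected X(1) by (auto simp: connected_graph_def)
    then have "y \<in> X \<or> crossing X (T - X) \<noteq> {}"
    proof induction
      case base
      then show ?case using xy by simp
    next
      case (step y z)
      then have "{y, z} \<in> E" "z \<in> T" by (auto simp: mem_edges_in_iff)
      then show ?case using step.IH crossingI[of y z X "T - X"] by blast
    qed
    then show ?thesis using xy by simp
  qed
  then show "connected_on T" using connected by (simp add: connected_on_def connected_graph_def)
next
  assume connected: "connected_on T"
  have "(u, v) \<in> {(x, y). {x, y} \<in> edges_in T}\<^sup>*" if uv: "u \<in> T" "v \<in> T" for u v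
  proof (rule ccontr)
    assume unreachable: "(u, v) \<notin> {(x, y). {x, y} \<in> edges_in T}\<^sup>*"
    define Z where "Z = {z \<in> T. (u, z) \<in> {(x, y). {x, y} \<in> edges_in T}\<^sup>*}"
    have "Z \<subseteq> T" "u \<in> Z" "v \<notin> Z" using uv unreachable by (auto simp: Z_def)
    then obtain x y where xy: "x \<in> Z" "y \<in> T - Z" "{x, y} \<in> E"
      using connected_onE[OF connected, of Z] uv(2) by blast
    then have "(x, y) \<in> {(x, y). {x, y} \<in> edges_in T}" by (simp add: mem_edges_in_iff Z_def)
    then have "y \<in> Z" using xy by (auto simp: Z_def intro: rtrancl_into_rtrancl)
    then show False using xy by simp
  qed
  then show "connected_graph (induced T)"
    using connected_on_nonempty[OF connected] by (simp add: connected_graph_def)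
qed

lemma contains_cycle_induced_iff:
  assumes "T \<subseteq> V"
  shows "contains_family {cycle_graph n | n. n \<ge> k} (induced T) \<longleftrightarrow> (\<exists>C\<subseteq>T. cycle_set k C)"
proof
  assume "contains_family {cycle_graph n | n. n \<ge> k} (induced T)"
  then obtain K n where K: "subgraph_of K (induced T)" "graph_iso K (cycle_graph n)" "n \<ge> k"
    by (auto simp: contains_family_def)
  then have "subgraph_of K G" "verts K \<subseteq> T" using assms by (auto simp: subgraph_of_def edges_in_def)
  then show "\<exists>C\<subseteq>T. cycle_set k C" using K(2,3) by (auto simp: cycle_set_def)
next
  assume "\<exists>C\<subseteq>T. cycle_set k C"
  then obtain K n where K: "subgraph_of K G" "simple_graph K" "verts K \<subseteq> T" "n \<ge> k"
    "graph_iso K (cycle_graph n)" by (metis cycle_setE)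
  then have "subgraph_of K (induced T)"
    using edges_subset_Pow[OF K(2)] by (auto simp: subgraph_of_def edges_in_def)
  then show "contains_family {cycle_graph n | n. n \<ge> k} (induced T)"
    using K(4,5) by (auto simp: contains_family_def)
qed

lemma tree_induced:
  assumes "T \<subseteq> V" "tree_on T" shows "tree (induced T)"
  using assms simple_induced[OF assms(1)] contains_cycle_induced_iff[OF assms(1), of 3]
    tree_on_acyclic[OF assms] by (auto simp: tree_def tree_on_def connected_graph_induced_iff)

lemma isolating_set_iff: "isolating_set G long_cycles D \<longleftrightarrow> D \<subseteq> V \<and> isolates V D"
proof -
  have "delete_verts G (N D) = induced (V - N D)"
    using edge_subset_V by (auto simp: delete_verts_def induced_def edges_in_def)
  then have "isolating_set G long_cycles D \<longleftrightarrow> D \<subseteq> V \<and> \<not> (\<exists>C\<subseteq>V - N D. cycle_set 4 C)"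
    using contains_cycle_induced_iff[of "V - N D" 4]
    by (simp add: isolating_set_def long_cycles_def)
  moreover have "C \<subseteq> V - N D \<longleftrightarrow> C \<subseteq> V \<and> C \<inter> N D = {}" for C by blast
  ultimately show ?thesis unfolding isolates_def by metis
qed

lemma isolation_number_attained:
  obtains D where "D \<subseteq> V" "isolates V D" "card D = isolation_number G long_cycles"
proof -
  have "isolates V V" by (intro isolates_if_few_left[of _ _ "{}"]) (auto simp: mem_N_iff)
  then have "\<exists>k D. isolating_set G long_cycles D \<and> card D = k" using isolating_set_iff by blast
  then have "\<exists>D. isolating_set G long_cycles D \<and> card D = isolation_number G long_cycles"
    unfolding isolation_number_def by (rule LeastI_ex)
  then show ?thesis using that isolating_set_iff by blast
qed

lemma isolation_number_le:
  assumes "D \<subseteq> V" "isolates V D" shows "isolation_number G long_cycles \<le> card D"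
  unfolding isolation_number_def using assms isolating_set_iff by (intro Least_le) blast

lemma isolable_V_iff: "isolable V k \<longleftrightarrow> 6 * isolation_number G long_cycles \<le> k"
proof
  assume "isolable V k"
  then obtain D where "D \<subseteq> V" "isolates V D" "6 * card D \<le> k" by (auto simp: isolable_def)
  then show "6 * isolation_number G long_cycles \<le> k" using isolation_number_le[of D] by simp
next
  assume "6 * isolation_number G long_cycles \<le> k"
  then show "isolable V k" using isolation_number_attained unfolding isolable_def by metis
qed

lemma isolation_number_pos:
  assumes "cycle_set 4 C" shows "isolation_number G long_cycles > 0"
proof -
  obtain D where D: "D \<subseteq> V" "isolates V D" "card D = isolation_number G long_cycles"
    by (rule isolation_number_attained)
  have "D \<noteq> {}" using isolatesD[OF D(2) assms cycle_set_subset_V[OF assms]] by auto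
  then show ?thesis using D(1,3) finite_vertex_set[OF D(1)] by (simp add: card_gt_0_iff flip: D(3))
qed

lemma constituent_eq_induced:
  assumes "t \<in> B" "crossing {t} (B - {t}) = {{t, w}}"
  shows "constituent t (induced (B - {t})) w = induced B"
proof -
  have B: "{t} \<union> (B - {t}) = B" using assms(1) by auto
  have "edges_in B = edges_in (B - {t}) \<union> {{t, w}}"
    using edges_in_Un[of "{t}" "B - {t}"] assms(2) unfolding B by simp
  then show ?thesis using B by (simp add: constituent_def induced_def)
qed

lemma
  assumes pure: "pure_special V T B" and T: "v ` I = T"
    and w: "\<And>t. t \<in> T \<Longrightarrow> w t \<in> B t - {t} \<and> crossing {t} (B t - {t}) = {{t, w t}}"
  shows UN_verts_constituent:
      "(\<Union>i\<in>I. verts (constituent (v i) (induced (B (v i) - {v i})) (w (v i)))) = V"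
    and UN_edges_constituent:
      "(\<Union>i\<in>I. edges (constituent (v i) (induced (B (v i) - {v i})) (w (v i)))) =
        (\<Union>t\<in>T. edges_in (B t))"
proof -
  have "constituent (v i) (induced (B (v i) - {v i})) (w (v i)) = induced (B (v i))"
    if "i \<in> I" for i
  proof -
    have "v i \<in> T" using T that by blast
    then show ?thesis
      using pure_special_pendant[OF pure] w
      by (intro constituent_eq_induced) (auto simp: pendant_square_def)
  qed
  then show "(\<Union>i\<in>I. verts (constituent (v i) (induced (B (v i) - {v i})) (w (v i)))) = V"
    and "(\<Union>i\<in>I. edges (constituent (v i) (induced (B (v i) - {v i})) (w (v i)))) =
      (\<Union>t\<in>T. edges_in (B t))"
    using pure_special_cover[OF pure] unfolding T[symmetric] by simp_all
qed

lemma pure_special_decomposition: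
  assumes pure: "pure_special V T B" and v: "bij_betw v {1..q} T"
    and w: "\<And>t. t \<in> T \<Longrightarrow> w t \<in> B t - {t} \<and> crossing {t} (B t - {t}) = {{t, w t}}"
  shows "special_decomposition q 0 G v (\<lambda>i. induced (B (v i) - {v i})) (\<lambda>i. w (v i))
    (induced T) \<lparr>verts = {v q}, edges = {}\<rparr>"
proof -
  have T: "v ` {1..q} = T" and inj_v: "inj_on v {1..q}" using v by (simp_all add: bij_betw_def)
  then have v_T: "v i \<in> T" if "i \<in> {1..q}" for i using that by blast
  have "T \<noteq> {}" using pure_special_tree[OF pure] connected_on_nonempty by (auto simp: tree_on_def)
  then have "q \<ge> 1" using T by (cases q) auto
  let ?F = "\<lambda>i. induced (B (v i) - {v i})"
  show ?thesis
    unfolding special_decomposition_def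
  proof (intro conjI ballI impI)
    fix i assume i: "i \<in> {1..q}"
    show "simple_graph (?F i)" "graph_iso (?F i) (cycle_graph 4)"
      using simple_induced[of "B (v i) - {v i}"] pure_special_pendant[OF pure v_T[OF i]]
        constituent_subset[OF pure v_T[OF i]] by (auto simp: pendant_square_def)
    show "verts (?F i) \<inter> v ` {1..q} = {}"
      using constituent_Int_hubs[OF order_refl pure v_T[OF i]] unfolding T induced_simps by blast
    show "w (v i) \<in> verts (?F i)" using w[OF v_T[OF i]] by simp
    fix j assume j: "j \<in> {1..q}" "i \<noteq> j"
    then have "v i \<noteq> v j" using inj_onD[OF inj_v] i by blast
    then show "verts (?F i) \<inter> verts (?F j) = {}"
      using disjoint_family_onD[OF pure_special_disjoint[OF pure] v_T[OF i] v_T[OF j(1)]]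
      unfolding induced_simps by blast
  next
    show "tree (induced T)" "verts (induced T) = v ` {1..q}"
      using tree_induced hubs_subset[OF pure] pure_special_tree[OF pure] T by simp_all
    have "v q \<in> V" using v_T[of q] hubs_subset[OF pure] \<open>q \<ge> 1\<close> by auto
    then show "verts \<lparr>verts = {v q}, edges = {}\<rparr> \<inter>
        (\<Union>i\<in>{1..q}. verts (constituent (v i) (?F i) (w (v i)))) = {v q}"
      and "V = verts \<lparr>verts = {v q}, edges = {}\<rparr> \<union>
        (\<Union>i\<in>{1..q}. verts (constituent (v i) (?F i) (w (v i))))"
      using UN_verts_constituent[OF pure T w] by auto
    show "E = edges (induced T) \<union> edges \<lparr>verts = {v q}, edges = {}\<rparr> \<union>
        (\<Union>i\<in>{1..q}. edges (constituent (v i) (?F i) (w (v i))))"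
      using UN_edges_constituent[OF pure T w] pure_special_edges_in[OF order_refl pure] by simp
  qed (use \<open>q \<ge> 1\<close> inj_v in \<open>auto simp: simple_graph_def connected_graph_def\<close>)
qed

lemma pure_special_imp_pure_C4_special:
  assumes pure: "pure_special V T B"
  shows "pure_C4_special (card E) G"
proof -
  have m: "card E + 1 = 6 * card T" using pure_special_num_edges[OF order_refl pure] by simp
  obtain v where v: "bij_betw v {1..card T} T"
    using ex_bij_betw_nat_finite_1[OF finite_hubs[OF order_refl pure]] by blast
  have "\<forall>t\<in>T. \<exists>w. w \<in> B t - {t} \<and> crossing {t} (B t - {t}) = {{t, w}}"
    using pure_special_pendant[OF pure] pendant_square_attachmentE by metis
  then obtain w where "\<And>t. t \<in> T \<Longrightarrow> w t \<in> B t - {t} \<and> crossing {t} (B t - {t}) = {{t, w t}}"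
    using bchoice by metis
  note decomposition = pure_special_decomposition[OF pure v this]
  have "(card E + 1) div 6 = card T" "(card E + 1) mod 6 = 0" using m by simp_all
  then show ?thesis using decomposition unfolding pure_C4_special_def by fastforce
qed

context
  fixes q r v F w T T'
  assumes decomposition: "special_decomposition q r G v F w T T'"
begin

private abbreviation (input) K :: "nat \<Rightarrow> 'a set" where
  "K i \<equiv> verts (constituent (v i) (F i) (w i))"

lemma hubs_inj: "inj_on v {1..q}"
  and verts_tree: "verts T = v ` {1..q}"
  and simple_tree: "simple_graph T"
  and simple_remainder: "simple_graph T'"
  and verts_remainder: "verts T' \<inter> (\<Union>i\<in>{1..q}. K i) = {v q}"
  and last_hub: "v q \<in> v ` {1..q}"
  and decomposition_verts: "V = verts T' \<union> (\<Union>i\<in>{1..q}. K i)"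
  and decomposition_edges:
    "E = edges T \<union> edges T' \<union> (\<Union>i\<in>{1..q}. edges (constituent (v i) (F i) (w i)))"
  using decomposition unfolding special_decomposition_def tree_def by simp_all

lemma
  assumes "i \<in> {1..q}"
  shows simple_square: "simple_graph (F i)"
    and square_iso: "graph_iso (F i) (cycle_graph 4)"
    and square_Int_hubs: "verts (F i) \<inter> v ` {1..q} = {}"
    and attachment_mem: "w i \<in> verts (F i)"
    and squares_disjoint: "j \<in> {1..q} \<Longrightarrow> i \<noteq> j \<Longrightarrow> verts (F i) \<inter> verts (F j) = {}"
  using decomposition assms unfolding special_decomposition_def by simp_all

lemma decomposition_square_cycle:
  assumes "i \<in> {1..q}" shows "cycle_set 4 (verts (F i))"
proof -
  have "verts (F i) \<subseteq> K i" "edges (F i) \<subseteq> edges (constituent (v i) (F i) (w i))"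
    by (auto simp: constituent_def)
  then have "verts (F i) \<subseteq> V" "edges (F i) \<subseteq> E"
    using assms by (subst decomposition_verts decomposition_edges, blast)+
  then show ?thesis
    using simple_square[OF assms] square_iso[OF assms] unfolding cycle_set_def subgraph_of_def
    by blast
qed

lemma constituents_disjoint: "disjoint_family_on K {1..q}"
  unfolding disjoint_family_on_def
proof (intro ballI impI)
  fix i j assume i: "i \<in> {1..q}" and j: "j \<in> {1..q}" "i \<noteq> j"
  then have "v i \<noteq> v j" using inj_onD[OF hubs_inj] by blast
  then show "K i \<inter> K j = {}"
    using square_Int_hubs[OF i] square_Int_hubs[OF j(1)] squares_disjoint[OF i j] i j(1)
    unfolding constituent_def by auto
qed

lemma constituent_closed:
  assumes i: "i \<in> {1..q}" and u: "u \<in> verts (F i)" and du: "{d, u} \<in> E"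
  shows "d \<in> K i"
proof -
  have u_K: "u \<in> K i" and u_v: "u \<notin> v ` {1..q}"
    using u square_Int_hubs[OF i] by (auto simp: constituent_def)
  have "u \<notin> verts T" using u_v verts_tree by simp
  moreover have "u \<notin> verts T'"
  proof
    assume "u \<in> verts T'"
    then have "u = v q" using verts_remainder i u_K by blast
    then show False using u_v last_hub by simp
  qed
  ultimately have "{d, u} \<notin> edges T" "{d, u} \<notin> edges T'"
    using edges_subset_Pow[OF simple_tree] edges_subset_Pow[OF simple_remainder] by auto
  then obtain j where j: "j \<in> {1..q}" "{d, u} \<in> edges (constituent (v j) (F j) (w j))"
    using du decomposition_edges by blast
  have "edges (constituent (v j) (F j) (w j)) \<subseteq> Pow (K j)"
    using edges_subset_Pow[OF simple_square[OF j(1)]] attachment_mem[OF j(1)]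
    by (auto simp: constituent_def)
  then have "d \<in> K j" "u \<in> K j" using j(2) by auto
  then have "i = j" using disjoint_family_onD[OF constituents_disjoint i j(1)] u_K by blast
  then show ?thesis using \<open>d \<in> K j\<close> by simp
qed

lemma isolates_meets_constituent:
  assumes "isolates V D" "i \<in> {1..q}"
  shows "D \<inter> K i \<noteq> {}"
proof -
  note cycle = decomposition_square_cycle[OF assms(2)]
  obtain u where u: "u \<in> verts (F i)" "u \<in> N D"
    using isolatesD[OF assms(1) cycle cycle_set_subset_V[OF cycle]] by blast
  then consider (chosen) "u \<in> D" | (adjacent) d where "d \<in> D" "{d, u} \<in> E"
    by (auto simp: mem_N_iff)
  then show ?thesis
  proof cases
    case chosen
    then show ?thesis using u(1) by (auto simp: constituent_def)
  next
    case adjacent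
    then show ?thesis using constituent_closed[OF assms(2) u(1)] by blast
  qed
qed

lemma special_decomposition_isolation_number_ge: "q \<le> isolation_number G long_cycles"
proof -
  obtain D where D: "D \<subseteq> V" "isolates V D" "card D = isolation_number G long_cycles"
    by (rule isolation_number_attained)
  have "card {1..q} \<le> card D"
    using finite_vertex_set[OF D(1)] constituents_disjoint isolates_meets_constituent[OF D(2)]
    by (rule card_index_le_if_disjoint)
  then show ?thesis using D(3) by simp
qed

end

context
  assumes connected: "connected_graph G" and not_C4: "\<not> graph_iso G (cycle_graph 4)"
begin

lemma slack_or_extremal: "slack V \<or> extremal V"
  using connected_on_classified[of V] connected not_C4 connected_graph_induced_iff[of V]
  by (simp add: classified_def)

lemma isolation_number_upper_bound: "6 * isolation_number G long_cycles \<le> card E + 1"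
  using slack_or_extremal_isolable[OF order_refl slack_or_extremal] isolable_V_iff by simp

lemma isolation_number_eq_iff:
  "6 * isolation_number G long_cycles = card E + 1 \<longleftrightarrow>
     pure_C4_special (card E) G \<or> graph_iso G diamond_graph \<or> graph_iso G (cycle_graph 5)"
proof
  assume "6 * isolation_number G long_cycles = card E + 1"
  then have "\<not> slack V" using isolable_V_iff by simp
  then have "extremal V" using slack_or_extremal by simp
  then show "pure_C4_special (card E) G \<or> graph_iso G diamond_graph \<or> graph_iso G (cycle_graph 5)"
    using pure_special_imp_pure_C4_special by (auto simp: extremal_def)
next
  assume "pure_C4_special (card E) G \<or> graph_iso G diamond_graph \<or> graph_iso G (cycle_graph 5)"
  then have "card E + 1 \<le> 6 * isolation_number G long_cycles"
  proof (elim disjE)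
    assume "pure_C4_special (card E) G"
    then obtain v F w T T' where
      decomposition: "special_decomposition ((card E + 1) div 6) ((card E + 1) mod 6) G v F w T T'"
      and "edges T' = {}" by (auto simp: pure_C4_special_def)
    then have "(card E + 1) mod 6 = 0" by (simp add: special_decomposition_def)
    then show ?thesis
      using special_decomposition_isolation_number_ge[OF decomposition] by presburger
  next
    assume diamond: "graph_iso G diamond_graph"
    then show ?thesis
      using isolation_number_pos[of V] diamond_cycle_set[of V] diamond_num_edges[of V] by simp
  next
    assume pentagon: "graph_iso G (cycle_graph 5)"
    then show ?thesis
      using isolation_number_pos[of V] induced_cycle_cycle_set[of V 5 4] pentagon_num_edges[of V]
      by simp
  qed
  then show "6 * isolation_number G long_cycles = card E + 1"
    using isolation_number_upper_bound by simp
qed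

lemma C4_special_isolation_number:
  assumes "C4_special (card E) G"
  shows "isolation_number G long_cycles = (card E + 1) div 6"
proof -
  have "(card E + 1) div 6 \<le> isolation_number G long_cycles"
    using assms special_decomposition_isolation_number_ge
    by (cases "(card E + 1) div 6 = 0") (auto simp: C4_special_def Let_def)
  then show ?thesis using isolation_number_upper_bound by linarith
qed

end

end

theorem theorem1p4:
  fixes G :: "'a ugraph" and m :: nat
  assumes "simple_graph G"
    and "connected_graph G"
    and "card (edges G) = m"
    and "\<not> graph_iso G (cycle_graph 4)"
  shows "real (isolation_number G long_cycles) \<le> (real m + 1) / 6 \<and>
    (real (isolation_number G long_cycles) = (real m + 1) / 6 \<longleftrightarrow>
       pure_C4_special m G \<or> graph_iso G diamond_graph \<or> graph_iso G (cycle_graph 5)) \<and>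
    (C4_special m G \<longrightarrow>
       int (isolation_number G long_cycles) = \<lfloor>(real m + 1) / 6\<rfloor>)"
proof -
  let ?i = "isolation_number G long_cycles"
  interpret finite_simple_graph G using assms(1) by unfold_locales
  have "6 * ?i \<le> m + 1" using isolation_number_upper_bound[OF assms(2,4)] assms(3) by simp
  moreover have "real ?i = (real m + 1) / 6 \<longleftrightarrow> real (6 * ?i) = real (m + 1)" by auto
  then have "real ?i = (real m + 1) / 6 \<longleftrightarrow> 6 * ?i = m + 1" by (simp only: of_nat_eq_iff)
  moreover have "6 * ?i = m + 1 \<longleftrightarrow>
      pure_C4_special m G \<or> graph_iso G diamond_graph \<or> graph_iso G (cycle_graph 5)"
    using isolation_number_eq_iff[OF assms(2,4)] assms(3) by simp
  moreover have "int ?i = \<lfloor>(real m + 1) / 6\<rfloor>" if "C4_special m G"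
  proof -
    have "?i = (m + 1) div 6" using C4_special_isolation_number[OF assms(2,4)] that assms(3) by simp
    then show ?thesis
      using floor_divide_of_nat_eq[of "m + 1" 6, where ?'a = real] by (simp add: add.commute)
  qed
  ultimately show ?thesis by auto
qed

end
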